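(* For every integer $d\ge 4$ there exists an infinite family of pairwise combinatorially distinct inscribed $d$-dimensional polytopes $P_n$, $n\ge 1$, where $P_n$ has $12(n+1)+d-4$ vertices and $\dim\mathcal{RS}(P_n)\le 76+d(d+1)$ for all $n\ge1$.
   Context: A polytope is inscribed if all its vertices lie on a common sphere. For a $d$-polytope $P$ with labelled vertices, the realization space $\mathcal{RS}(P)$ is the semialgebraic set of all labelled vertex tuples $V\in(S^d)^{f_0(P)}$ such that $\mathrm{conv}(V)$ is combinatorially equivalent to $P$ via a face-lattice isomorphism respecting the labelling; its dimension is well defined. *)

theory Defs
  imports "HOL-Analysis.Analysis"
begin

section \<open>Semialgebraic sets and their dimension\<close>

text \<open>For a finite index set \<open>J\<close>, the space $\mathbb{R}^J$ is \<open>J \<rightarrow>\<^sub>E UNIV\<close>. The topology on it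
  is induced by the product topology of the library on functions; for finite \<open>J\<close> this is the
  Euclidean topology.\<close>

inductive real_poly_fun :: "'j set \<Rightarrow> (('j \<Rightarrow> real) \<Rightarrow> real) \<Rightarrow> bool" for J where
  const: "real_poly_fun J (\<lambda>x. c)"
| coord: "j \<in> J \<Longrightarrow> real_poly_fun J (\<lambda>x. x j)"
| add: "real_poly_fun J p \<Longrightarrow> real_poly_fun J q \<Longrightarrow> real_poly_fun J (\<lambda>x. p x + q x)"
| mult: "real_poly_fun J p \<Longrightarrow> real_poly_fun J q \<Longrightarrow> real_poly_fun J (\<lambda>x. p x * q x)"

inductive semialgebraic :: "'j set \<Rightarrow> ('j \<Rightarrow> real) set \<Rightarrow> bool" for J where
  pos: "real_poly_fun J p \<Longrightarrow> semialgebraic J {x \<in> J \<rightarrow>\<^sub>E UNIV. p x > 0}"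
| compl: "semialgebraic J A \<Longrightarrow> semialgebraic J ((J \<rightarrow>\<^sub>E UNIV) - A)"
| inter: "semialgebraic J A \<Longrightarrow> semialgebraic J B \<Longrightarrow> semialgebraic J (A \<inter> B)"

text \<open>A map is semialgebraic if its graph is; \<open>case_sum x y\<close> is the point $(x,y)$ of
  $\mathbb{R}^I \times \mathbb{R}^J = \mathbb{R}^{I \sqcup J}$.\<close>

definition semialgebraic_map ::
    "'i set \<Rightarrow> 'j set \<Rightarrow> ('i \<Rightarrow> real) set \<Rightarrow> (('i \<Rightarrow> real) \<Rightarrow> ('j \<Rightarrow> real)) \<Rightarrow> bool" where
  "semialgebraic_map I J A f \<longleftrightarrow> semialgebraic (I <+> J) ((\<lambda>x. case_sum x (f x)) ` A)"

definition open_cube :: "nat \<Rightarrow> (nat \<Rightarrow> real) set" where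
  "open_cube k = {..<k} \<rightarrow>\<^sub>E {0<..<1}"

definition contains_open_cell :: "'j set \<Rightarrow> ('j \<Rightarrow> real) set \<Rightarrow> nat \<Rightarrow> bool" where
  "contains_open_cell J A k \<longleftrightarrow>
     (\<exists>f g. f ` open_cube k \<subseteq> A \<and> homeomorphism (open_cube k) (f ` open_cube k) f g \<and>
            semialgebraic_map {..<k} J (open_cube k) f)"

text \<open>The dimension of a semialgebraic set is the largest dimension of a cell (a subset
  semialgebraically homeomorphic to an open cube) contained in it. It is extended-real valued so
  that the empty set gets dimension $-\infty$ and the supremum is meaningful without a proof of
  boundedness.\<close>

definition semialgebraic_dim :: "'j set \<Rightarrow> ('j \<Rightarrow> real) set \<Rightarrow> ereal" where
  "semialgebraic_dim J A = (SUP k \<in> {k. contains_open_cell J A k}. ereal (real k))"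

section \<open>Polytopes and combinatorial equivalence\<close>

definition vertices :: "'a::euclidean_space set \<Rightarrow> 'a set" where
  "vertices P = {v. v extreme_point_of P}"

definition inscribed :: "'a::euclidean_space set \<Rightarrow> bool" where
  "inscribed P \<longleftrightarrow> (\<exists>c r. r > 0 \<and> vertices P \<subseteq> sphere c r)"

definition faces :: "'a::euclidean_space set \<Rightarrow> 'a set set" where
  "faces P = {F. F face_of P}"

definition lattice_iso :: "('a set \<Rightarrow> 'b set) \<Rightarrow> 'a set set \<Rightarrow> 'b set set \<Rightarrow> bool" where
  "lattice_iso \<phi> L M \<longleftrightarrow>
     bij_betw \<phi> L M \<and> (\<forall>F\<in>L. \<forall>G\<in>L. F \<subseteq> G \<longleftrightarrow> \<phi> F \<subseteq> \<phi> G)"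

definition comb_equiv :: "'a::euclidean_space set \<Rightarrow> 'b::euclidean_space set \<Rightarrow> bool" where
  "comb_equiv P Q \<longleftrightarrow> (\<exists>\<phi>. lattice_iso \<phi> (faces P) (faces Q))"

section \<open>Spherical polytopes and realization spaces\<close>

text \<open>A spherical polytope is the spherical convex hull of finitely many points of the unit sphere
  that lie in a common open hemisphere. Its faces, including the empty one and the polytope itself
  (\<open>a = 0\<close>), are cut out by the closed hemispheres containing it.\<close>

definition in_open_hemisphere :: "'a::euclidean_space set \<Rightarrow> bool" where
  "in_open_hemisphere S \<longleftrightarrow> S \<subseteq> sphere 0 1 \<and> (\<exists>a. \<forall>x\<in>S. a \<bullet> x > 0)"

definition spherical_hull :: "'a::euclidean_space set \<Rightarrow> 'a set" where
  "spherical_hull S = sphere 0 1 \<inter> conic hull (convex hull S)"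

definition spherical_faces :: "'a::euclidean_space set \<Rightarrow> 'a set set" where
  "spherical_faces Q = {Q \<inter> {x. a \<bullet> x = 0} | a. \<forall>x\<in>Q. a \<bullet> x \<ge> 0}"

text \<open>For a \<open>d\<close>-polytope \<open>P\<close> in the \<open>d\<close>-dimensional space \<open>'a\<close>, the sphere $S^d$ is the unit sphere
  of \<open>'a \<times> real\<close>. The vertices of \<open>P\<close> serve as their own labels, so a labelled vertex tuple is a
  function on \<open>vertices P\<close>.\<close>

definition realization_space :: "'a::euclidean_space set \<Rightarrow> ('a \<Rightarrow> 'a \<times> real) set" where
  "realization_space P =
     {V \<in> vertices P \<rightarrow>\<^sub>E sphere 0 1.
        in_open_hemisphere (V ` vertices P) \<and>
        (\<exists>\<phi>. lattice_iso \<phi> (faces P) (spherical_faces (spherical_hull (V ` vertices P))) \<and>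
             (\<forall>v\<in>vertices P. \<phi> {v} = {V v}))}"

definition tuple_coords ::
    "'i set \<Rightarrow> ('i \<Rightarrow> 'b::euclidean_space) \<Rightarrow> ('i \<times> 'b \<Rightarrow> real)" where
  "tuple_coords I V = (\<lambda>(i, b) \<in> I \<times> Basis. V i \<bullet> b)"

definition dim_RS :: "'a::euclidean_space set \<Rightarrow> ereal" where
  "dim_RS P = semialgebraic_dim (vertices P \<times> Basis)
                (tuple_coords (vertices P) ` realization_space P)"

end

theory Submission
  imports Defs "HOL-Homology.Homology"
begin

text \<open>
  The complement of a great circle in the unit sphere of $\mathbb{R}^4$ is conformally
  $\mathbb{H}^2 \times S^1$. Take a regular hyperbolic quadrilateral with sides of length
  $\mathrm{arcosh}\,2$, extend its sides to geodesics, and mark on each of them, starting from the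
  midpoint of the side, points at distance $\mathrm{arcosh}\,2$ in one direction. Placing three
  points of $S^1$ over each marked point, alternately the even and the odd sixth roots of unity, gives
  layers of 12 points on the sphere. They form a quotient of the layers $x + y + z = i$ of the cubical
  lattice $\mathbb{Z}^3$: steps along a geodesic with rotation by $\pm\pi/3$ are the first two unit
  vectors, and the reflection at the corner of the quadrilateral from one geodesic to the
  preceding one is the third. Every lattice cube whose lowest layer is at least $-1$ spans a
  supporting hyperplane of the convex hull of the layers $0, \dots, n$, so the lattice squares are
  2-faces.

  In any realization the three squares below a vertex $w$ span planes meeting only in $w$, and each
  plane is spanned by vertices of the two preceding layers. Hence the 24 vertices of the layers 0
  and 1, as points of $S^4$, determine a realization, which leaves at most $4 \cdot 24$ parameters.
  Iterated pyramids with the remaining basis vectors as apexes give the result for $d > 4$.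
\<close>

section \<open>Face lattices of polytopes\<close>

lemma lattice_isoD:
  assumes "lattice_iso \<phi> L M"
  shows "bij_betw \<phi> L M"
    and "F \<in> L \<Longrightarrow> \<phi> F \<in> M"
    and "F \<in> L \<Longrightarrow> G \<in> L \<Longrightarrow> \<phi> F \<subseteq> \<phi> G \<longleftrightarrow> F \<subseteq> G"
  using assms by (auto simp: lattice_iso_def bij_betw_def)

lemma lattice_iso_comp:
  assumes \<phi>: "lattice_iso \<phi> K L" and \<psi>: "lattice_iso \<psi> L M"
  shows "lattice_iso (\<psi> \<circ> \<phi>) K M"
  using lattice_isoD[OF \<phi>] lattice_isoD[OF \<psi>] bij_betw_trans[of \<phi> K L \<psi> M]
  by (auto simp: lattice_iso_def)

lemma lattice_iso_inv_into:
  assumes "lattice_iso \<phi> L M"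
  shows "lattice_iso (inv_into L \<phi>) M L"
proof -
  note bij = lattice_isoD(1)[OF assms]
  have inv_bij: "bij_betw (inv_into L \<phi>) M L" using bij by (rule bij_betw_inv_into)
  moreover have "F \<subseteq> G \<longleftrightarrow> inv_into L \<phi> F \<subseteq> inv_into L \<phi> G" if "F \<in> M" "G \<in> M" for F G
    using lattice_isoD(3)[OF assms, of "inv_into L \<phi> F" "inv_into L \<phi> G"] bij_betw_apply[OF inv_bij]
      that
    by (simp add: bij_betw_inv_into_right[OF bij])
  ultimately show ?thesis by (simp add: lattice_iso_def)
qed

lemma polytope_face_codim_1_exists:
  fixes S :: "'a::euclidean_space set"
  assumes "polytope S" "S \<noteq> {}"
  obtains G where "G face_of S" "aff_dim G = aff_dim S - 1"
proof (cases "aff_dim S = 0")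
  case True
  then show thesis using that[of "{}"] by simp
next
  case False
  then have "0 < aff_dim S" using assms(2) aff_dim_negative_iff[of S] by linarith
  then obtain F where "F facet_of S" using polytope_facet_exists assms(1) by blast
  then show thesis using that[of F] by (simp add: facet_of_def)
qed

lemma lattice_iso_faces_aff_dim_le:
  fixes P :: "'a::euclidean_space set" and Q :: "'b::euclidean_space set"
  assumes P: "polytope P" and iso: "lattice_iso \<phi> (faces P) (faces Q)" and F: "F face_of P"
  shows "aff_dim F \<le> aff_dim (\<phi> F)"
  using F
proof (induction "nat (aff_dim F + 1)" arbitrary: F rule: less_induct)
  case less
  note iso_faces = lattice_isoD[OF iso, unfolded faces_def mem_Collect_eq]
  show ?case
  proof (cases "F = {}")
    case True
    then show ?thesis using aff_dim_geq[of "\<phi> F"] by simp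
  next
    case False
    have "polytope F" using less.prems P face_of_polytope_polytope by blast
    then obtain G where G: "G face_of F" "aff_dim G = aff_dim F - 1"
      using polytope_face_codim_1_exists False by blast
    have GP: "G face_of P" using G less.prems face_of_trans by blast
    have "aff_dim F \<ge> 0" using False by (metis aff_dim_negative_iff not_less)
    then have IH: "aff_dim G \<le> aff_dim (\<phi> G)" using less.hyps[OF _ GP] G by auto
    have "G \<subseteq> F" "\<not> F \<subseteq> G" using G face_of_imp_subset by fastforce+
    then have sub: "\<phi> G \<subseteq> \<phi> F" "\<phi> G \<noteq> \<phi> F"
      using iso_faces(3)[OF GP less.prems] iso_faces(3)[OF less.prems GP] by auto
    moreover have faces: "\<phi> G face_of Q" "\<phi> F face_of Q" using iso_faces(2) GP less.prems by auto
    ultimately have "\<phi> G face_of \<phi> F" using face_of_subset face_of_imp_subset by blast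
    then have "aff_dim (\<phi> G) < aff_dim (\<phi> F)"
      using face_of_aff_dim_lt sub(2) face_of_imp_convex[OF faces(2)] by blast
    then show ?thesis using IH G(2) by simp
  qed
qed

lemma lattice_iso_faces_aff_dim:
  fixes P :: "'a::euclidean_space set" and Q :: "'b::euclidean_space set"
  assumes P: "polytope P" and Q: "polytope Q" and iso: "lattice_iso \<phi> (faces P) (faces Q)"
    and F: "F face_of P"
  shows "aff_dim (\<phi> F) = aff_dim F"
proof (rule antisym)
  have "\<phi> F face_of Q" using lattice_isoD(2)[OF iso] F by (simp add: faces_def)
  moreover have "inv_into (faces P) \<phi> (\<phi> F) = F"
    using bij_betw_inv_into_left[OF lattice_isoD(1)[OF iso], of F] F by (simp add: faces_def)
  ultimately show "aff_dim (\<phi> F) \<le> aff_dim F"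
    using lattice_iso_faces_aff_dim_le[OF Q lattice_iso_inv_into[OF iso]] by metis
qed (rule lattice_iso_faces_aff_dim_le[OF P iso F])

lemma finite_vertices:
  fixes P :: "'a::euclidean_space set"
  assumes "polytope P"
  shows "finite (vertices P)"
  using finite_polyhedron_extreme_points[OF polytope_imp_polyhedron[OF assms]]
  by (simp add: vertices_def)

lemma comb_equiv_card_vertices_eq:
  fixes P :: "'a::euclidean_space set" and Q :: "'b::euclidean_space set"
  assumes P: "polytope P" and Q: "polytope Q" and "comb_equiv P Q"
  shows "card (vertices P) = card (vertices Q)"
proof -
  obtain \<phi> where iso: "lattice_iso \<phi> (faces P) (faces Q)" using assms by (auto simp: comb_equiv_def)
  have points: "(\<lambda>v. {v}) ` vertices S = {F \<in> faces S. aff_dim F = 0}"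
    for S :: "'c::euclidean_space set"
    by (auto simp: vertices_def faces_def face_of_singleton aff_dim_eq_0)
  have dim: "aff_dim (\<phi> F) = aff_dim F" if "F \<in> faces P" for F
    using lattice_iso_faces_aff_dim[OF P Q iso] that by (simp add: faces_def)
  have "{F \<in> \<phi> ` faces P. aff_dim F = 0} = \<phi> ` {F \<in> faces P. aff_dim F = 0}" using dim by auto
  moreover have "\<phi> ` faces P = faces Q" using lattice_isoD(1)[OF iso] by (rule bij_betw_imp_surj_on)
  ultimately have "\<phi> ` {F \<in> faces P. aff_dim F = 0} = {F \<in> faces Q. aff_dim F = 0}" by simp
  moreover have "inj_on \<phi> {F \<in> faces P. aff_dim F = 0}"
    by (rule inj_on_subset[OF bij_betw_imp_inj_on[OF lattice_isoD(1)[OF iso]]]) simp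
  ultimately have "bij_betw \<phi> ((\<lambda>v. {v}) ` vertices P) ((\<lambda>v. {v}) ` vertices Q)"
    unfolding points by (simp add: bij_betw_def)
  then have "card ((\<lambda>v. {v}) ` vertices P) = card ((\<lambda>v. {v}) ` vertices Q)"
    by (rule bij_betw_same_card)
  then show ?thesis by (simp add: card_image)
qed

section \<open>Faces and vertices of convex hulls\<close>

lemma face_of_convex_hull_eq:
  fixes S :: "'a::euclidean_space set"
  assumes "finite S" "F face_of convex hull S"
  shows "F = convex hull (S \<inter> F)"
proof
  obtain T where "T \<subseteq> S" "F = convex hull T"
    using face_of_convex_hull_subset[OF finite_imp_compact[OF assms(1)] assms(2)] by metis
  then show "F \<subseteq> convex hull (S \<inter> F)" by (metis hull_mono hull_subset le_inf_iff)
  show "convex hull (S \<inter> F) \<subseteq> F"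
    using face_of_imp_convex[OF assms(2)] by (intro hull_minimal) auto
qed

lemma convex_hull_zeros_face_of:
  fixes S :: "'a::euclidean_space set"
  assumes fin: "finite S" and nonneg: "\<And>x. x \<in> S \<Longrightarrow> a \<bullet> x + \<beta> \<ge> 0"
  defines "Z \<equiv> {x \<in> S. a \<bullet> x + \<beta> = 0}"
  shows "convex hull Z face_of convex hull S" "S \<inter> convex hull Z = Z"
proof -
  define F where "F = convex hull S \<inter> {x. a \<bullet> x = - \<beta>}"
  have "S \<subseteq> {x. a \<bullet> x \<ge> - \<beta>}" using nonneg by force
  then have "convex hull S \<subseteq> {x. a \<bullet> x \<ge> - \<beta>}" by (rule hull_minimal) (rule convex_halfspace_ge)
  then have face: "F face_of convex hull S"
    unfolding F_def by (intro face_of_Int_supporting_hyperplane_ge) auto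
  have SF: "S \<inter> F = Z" by (auto simp: F_def Z_def hull_inc)
  then have "F = convex hull Z" using face_of_convex_hull_eq[OF fin face] by simp
  then show "convex hull Z face_of convex hull S" "S \<inter> convex hull Z = Z" using face SF by auto
qed

lemma vertices_convex_hull_subset_sphere:
  fixes S :: "'a::euclidean_space set"
  assumes "S \<subseteq> sphere c r"
  shows "vertices (convex hull S) = S"
proof
  show "vertices (convex hull S) \<subseteq> S"
    by (auto simp: vertices_def dest: extreme_point_of_convex_hull)
  have ball: "convex hull S \<subseteq> cball c r" using assms by (intro hull_minimal) auto
  show "S \<subseteq> vertices (convex hull S)"
  proof
    fix x assume x: "x \<in> S"
    have "x \<notin> open_segment y z" if "y \<in> convex hull S" "z \<in> convex hull S" for y z
      using dist_decreases_open_segment[of x y z c] that ball x assms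
      by (force simp: dist_commute)
    then show "x \<in> vertices (convex hull S)"
      using x by (simp add: vertices_def extreme_point_of_def hull_inc)
  qed
qed

lemma extreme_point_notin_affine_hull_pair:
  fixes x y z :: "'a::euclidean_space"
  assumes "x extreme_point_of P" "y extreme_point_of P" "z extreme_point_of P"
    and "x \<noteq> y" "x \<noteq> z" "y \<noteq> z"
  shows "x \<notin> affine hull {y, z}"
proof
  assume "x \<in> affine hull {y, z}"
  then have "collinear {y, z, x}" using \<open>y \<noteq> z\<close> by (simp add: collinear_3_affine_hull)
  then have "x \<in> closed_segment y z \<or> y \<in> closed_segment x z \<or> z \<in> closed_segment x y"
    unfolding collinear_between_cases between_mem_segment by (auto simp: closed_segment_commute)
  then show False using assms by (auto simp: extreme_point_of_def open_segment_def)
qed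

lemma aff_dim_le_2_if_affine_combination:
  fixes p :: "'a::euclidean_space"
  assumes "p = u *\<^sub>R x + v *\<^sub>R y + w *\<^sub>R z" "u + v + w = 1"
  shows "aff_dim {p, x, y, z} \<le> 2"
proof -
  have "p \<in> affine hull {x, y, z}" using assms by (auto simp: affine_hull_3)
  then have "aff_dim {p, x, y, z} = aff_dim {x, y, z}" by (simp add: aff_dim_insert)
  also have "\<dots> \<le> int (card {x, y, z}) - 1" by (rule aff_dim_le_card) simp
  also have "card {x, y, z} \<le> 3" by (simp add: card_insert_if)
  finally show ?thesis by simp
qed

lemma aff_dim_Un_le_card:
  fixes A :: "'a::euclidean_space set"
  assumes "finite B"
  shows "aff_dim (A \<union> B) \<le> aff_dim A + int (card B)"
  using assms by induction (auto simp: aff_dim_insert)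

section \<open>Spherical polytopes and the gnomonic projection\<close>

lemma conic_hull_convex_hull_pos_scale:
  fixes S :: "'a::real_vector set"
  assumes pos: "\<And>x. x \<in> S \<Longrightarrow> c x > 0"
  shows "conic hull (convex hull ((\<lambda>x. c x *\<^sub>R x) ` S)) = conic hull (convex hull S)"
    (is "conic hull ?T = _")
proof
  have "c x *\<^sub>R x \<in> conic hull (convex hull S)" if "x \<in> S" for x
    using pos[OF that] that by (intro conicD[OF conic_conic_hull] hull_inc) auto
  then have "?T \<subseteq> conic hull (convex hull S)"
    by (intro hull_minimal convex_conic_hull convex_convex_hull) auto
  then show "conic hull ?T \<subseteq> conic hull (convex hull S)"
    by (rule hull_minimal) (rule conic_conic_hull)
  have "x \<in> conic hull ?T" if "x \<in> S" for x
  proof -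
    have "inverse (c x) *\<^sub>R (c x *\<^sub>R x) \<in> conic hull ?T"
      using pos[OF that] that
      by (intro conicD[OF conic_conic_hull] hull_inc) (auto simp: less_imp_le)
    then show ?thesis using pos[OF that] by simp
  qed
  then have "convex hull S \<subseteq> conic hull ?T"
    by (intro hull_minimal convex_conic_hull convex_convex_hull) auto
  then show "conic hull (convex hull S) \<subseteq> conic hull ?T"
    by (rule hull_minimal) (rule conic_conic_hull)
qed

lemma sgn_image_eq_sphere_Int_conic_hull:
  fixes P :: "'a::real_normed_vector set"
  assumes "0 \<notin> P"
  shows "sgn ` P = sphere 0 1 \<inter> conic hull P"
proof (intro equalityI subsetI)
  fix y assume "y \<in> sgn ` P"
  then obtain x where x: "x \<in> P" "y = inverse (norm x) *\<^sub>R x" by (auto simp: sgn_div_norm)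
  then have "x \<noteq> 0" using assms by auto
  then show "y \<in> sphere 0 1 \<inter> conic hull P"
    using x by (auto simp: conic_hull_explicit intro!: exI[of _ "inverse (norm x)"])
next
  fix y assume "y \<in> sphere 0 1 \<inter> conic hull P"
  then obtain c x where y: "norm y = 1" "y = c *\<^sub>R x" "c \<ge> 0" "x \<in> P"
    by (auto simp: conic_hull_explicit)
  then have "sgn y = sgn x" by (cases "c = 0") (auto simp: sgn_scaleR)
  moreover have "sgn y = y" using y by (simp add: sgn_div_norm)
  ultimately show "y \<in> sgn ` P" using y by (metis imageI)
qed

definition gnomonic :: "'a::euclidean_space \<Rightarrow> 'a \<Rightarrow> 'a" where
  "gnomonic a x = x /\<^sub>R (a \<bullet> x)"

lemma inner_gnomonic: "a \<bullet> x > 0 \<Longrightarrow> a \<bullet> gnomonic a x = 1"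
  by (simp add: gnomonic_def)

lemma inner_gnomonic_image:
  assumes "\<And>x. x \<in> S \<Longrightarrow> a \<bullet> x > 0" "y \<in> gnomonic a ` S"
  shows "a \<bullet> y = 1"
  using assms inner_gnomonic by blast

lemma sgn_gnomonic: "a \<bullet> x > 0 \<Longrightarrow> sgn (gnomonic a x) = sgn x"
  by (simp add: gnomonic_def sgn_scaleR)

lemma inner_convex_hull_gnomonic:
  assumes "\<And>x. x \<in> S \<Longrightarrow> a \<bullet> x > 0" "x \<in> convex hull (gnomonic a ` S)"
  shows "a \<bullet> x = 1"
proof -
  have "gnomonic a ` S \<subseteq> {x. a \<bullet> x = 1}" using inner_gnomonic_image[OF assms(1)] by auto
  then have "convex hull (gnomonic a ` S) \<subseteq> {x. a \<bullet> x = 1}"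
    by (rule hull_minimal) (rule convex_hyperplane)
  then show ?thesis using assms(2) by auto
qed

lemma sgn_image_convex_hull_gnomonic:
  assumes pos: "\<And>x. x \<in> S \<Longrightarrow> a \<bullet> x > 0"
  shows "sgn ` (convex hull (gnomonic a ` S)) = spherical_hull S"
proof -
  have "0 \<notin> convex hull (gnomonic a ` S)" using inner_convex_hull_gnomonic[OF pos] by fastforce
  moreover have "conic hull (convex hull (gnomonic a ` S)) = conic hull (convex hull S)"
    unfolding gnomonic_def[abs_def] using pos by (intro conic_hull_convex_hull_pos_scale) simp
  ultimately show ?thesis by (simp add: sgn_image_eq_sphere_Int_conic_hull spherical_hull_def)
qed

lemma inj_on_sgn_hyperplane:
  assumes "\<And>x. x \<in> P \<Longrightarrow> a \<bullet> x = 1"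
  shows "inj_on sgn P"
proof
  fix x y assume xy: "x \<in> P" "y \<in> P" "sgn x = sgn y"
  have "a \<bullet> sgn z = inverse (norm z)" if "z \<in> P" for z
    using assms[OF that] by (simp add: sgn_div_norm)
  then have "norm x = norm y" using xy by (metis inverse_inverse_eq)
  moreover have "x \<noteq> 0" "y \<noteq> 0" using assms xy by force+
  ultimately show "x = y" using xy(3) by (simp add: sgn_div_norm)
qed

lemma faces_polyhedron_subset_hyperplane:
  assumes poly: "polyhedron P" and a: "\<And>x. x \<in> P \<Longrightarrow> a \<bullet> x = 1"
  shows "faces P = {P \<inter> {x. c \<bullet> x = 0} | c. \<forall>x\<in>P. c \<bullet> x \<ge> 0}"
proof (intro equalityI subsetI)
  fix F assume "F \<in> faces P"
  then have "F exposed_face_of P" by (simp add: faces_def exposed_face_of_polyhedron[OF poly])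
  then obtain c b where support: "P \<subseteq> {x. c \<bullet> x \<le> b}" "F = P \<inter> {x. c \<bullet> x = b}"
    unfolding exposed_face_of_def by blast
  have "(b *\<^sub>R a - c) \<bullet> x = b - c \<bullet> x" if "x \<in> P" for x
    using a[OF that] by (simp add: inner_diff_left)
  then have "F = P \<inter> {x. (b *\<^sub>R a - c) \<bullet> x = 0}" "\<forall>x\<in>P. (b *\<^sub>R a - c) \<bullet> x \<ge> 0" using support by auto
  then show "F \<in> {P \<inter> {x. c \<bullet> x = 0} | c. \<forall>x\<in>P. c \<bullet> x \<ge> 0}" by blast
next
  fix F assume "F \<in> {P \<inter> {x. c \<bullet> x = 0} | c. \<forall>x\<in>P. c \<bullet> x \<ge> 0}"
  then show "F \<in> faces P"
    using polyhedron_imp_convex[OF poly]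
    by (auto simp: faces_def intro!: face_of_Int_supporting_hyperplane_ge)
qed

lemma spherical_faces_sgn_image:
  assumes "0 \<notin> P"
  shows "spherical_faces (sgn ` P) = image sgn ` {P \<inter> {x. c \<bullet> x = 0} | c. \<forall>x\<in>P. c \<bullet> x \<ge> 0}"
proof -
  have cut: "sgn ` P \<inter> {x. c \<bullet> x = 0} = sgn ` (P \<inter> {x. c \<bullet> x = 0})" for c
    using assms by (auto simp: sgn_div_norm)
  have support: "(\<forall>x\<in>sgn ` P. c \<bullet> x \<ge> 0) \<longleftrightarrow> (\<forall>x\<in>P. c \<bullet> x \<ge> 0)" for c
    using assms by (auto simp: sgn_div_norm zero_le_mult_iff)
  show ?thesis unfolding spherical_faces_def cut support by blast
qed

lemma lattice_iso_sgn_faces: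
  assumes poly: "polyhedron P" and a: "\<And>x. x \<in> P \<Longrightarrow> a \<bullet> x = 1"
  shows "lattice_iso (image sgn) (faces P) (spherical_faces (sgn ` P))"
proof -
  have "0 \<notin> P" using a by force
  then have "spherical_faces (sgn ` P) = image sgn ` faces P"
    by (simp add: spherical_faces_sgn_image faces_polyhedron_subset_hyperplane[OF poly a])
  moreover have "F \<subseteq> P" if "F \<in> faces P" for F
    using that face_of_imp_subset by (auto simp: faces_def)
  moreover have "inj_on sgn P" using a by (rule inj_on_sgn_hyperplane)
  ultimately show ?thesis
    by (auto simp: lattice_iso_def bij_betw_def inj_on_def inj_on_image_subset_iff
      inj_on_image_eq_iff)
qed

lemma aff_dim_eq_dim_hyperplane:
  fixes T :: "'a::euclidean_space set"
  assumes "\<And>x. x \<in> T \<Longrightarrow> a \<bullet> x = 1"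
  shows "aff_dim T = int (dim T) - 1"
proof -
  have "T \<subseteq> {x. a \<bullet> x = 1}" using assms by auto
  then have "affine hull T \<subseteq> {x. a \<bullet> x = 1}" by (rule hull_minimal) (rule affine_hyperplane)
  then have "0 \<notin> affine hull T" by auto
  then have "aff_dim T + 1 = aff_dim (insert 0 T)" by (simp add: aff_dim_insert)
  also have "\<dots> = int (dim (insert 0 T))" by (intro aff_dim_zero hull_inc) auto
  also have "\<dots> = int (dim T)" by (simp add: dim_insert span_zero)
  finally show ?thesis by simp
qed

lemma affine_hull_eq_span_Int_hyperplane:
  fixes T :: "'a::euclidean_space set"
  assumes T: "\<And>x. x \<in> T \<Longrightarrow> a \<bullet> x = 1"
  shows "affine hull T = span T \<inter> {x. a \<bullet> x = 1}"
proof (intro equalityI subsetI)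
  have "affine hull T \<subseteq> {x. a \<bullet> x = 1}" using T by (intro hull_minimal affine_hyperplane) auto
  then show "x \<in> span T \<inter> {x. a \<bullet> x = 1}" if "x \<in> affine hull T" for x
    using that affine_hull_subset_span by blast
  fix x assume x: "x \<in> span T \<inter> {x. a \<bullet> x = 1}"
  then have "aff_dim (insert x T) = aff_dim T"
    using T by (subst (1 2) aff_dim_eq_dim_hyperplane[where a = a]) (auto simp: dim_insert)
  then show "x \<in> affine hull T" by (simp add: aff_dim_insert split: if_splits)
qed

lemma span_gnomonic_image:
  assumes "finite T" "\<And>x. x \<in> T \<Longrightarrow> a \<bullet> x > 0"
  shows "span (gnomonic a ` T) = span T"
  unfolding gnomonic_def[abs_def]
proof (rule span_image_scale[OF assms(1)])
  show "inverse (a \<bullet> x) \<noteq> 0" if "x \<in> T" for x using assms(2)[OF that] by simp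
qed

lemma aff_dim_gnomonic_image:
  assumes "finite T" "\<And>x. x \<in> T \<Longrightarrow> a \<bullet> x > 0"
  shows "aff_dim (gnomonic a ` T) = int (dim T) - 1"
proof -
  have "aff_dim (gnomonic a ` T) = int (dim (gnomonic a ` T)) - 1"
    by (rule aff_dim_eq_dim_hyperplane) (rule inner_gnomonic_image[OF assms(2)])
  then show ?thesis using span_gnomonic_image[OF assms] by (metis dim_span)
qed

lemma gnomonic_in_affine_hull_iff:
  assumes "finite T" "\<And>x. x \<in> T \<Longrightarrow> a \<bullet> x > 0" "a \<bullet> x > 0"
  shows "gnomonic a x \<in> affine hull (gnomonic a ` T) \<longleftrightarrow> x \<in> span T"
proof -
  have "affine hull (gnomonic a ` T) = span T \<inter> {y. a \<bullet> y = 1}"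
    using affine_hull_eq_span_Int_hyperplane[OF inner_gnomonic_image[OF assms(2)]]
    by (simp add: span_gnomonic_image[OF assms(1,2)])
  moreover have "x = (a \<bullet> x) *\<^sub>R gnomonic a x" "gnomonic a x = inverse (a \<bullet> x) *\<^sub>R x"
    using assms(3) by (simp_all add: gnomonic_def)
  then have "gnomonic a x \<in> span T \<longleftrightarrow> x \<in> span T" by (metis span_scale)
  ultimately show ?thesis using inner_gnomonic[OF assms(3)] by simp
qed

section \<open>Labelled realizations\<close>

definition labelled_realization :: "'a::euclidean_space set \<Rightarrow> ('a \<Rightarrow> 'b::euclidean_space) \<Rightarrow> bool"
  where "labelled_realization P X \<longleftrightarrow>
     (\<exists>\<phi>. lattice_iso \<phi> (faces P) (faces (convex hull (X ` vertices P))) \<and>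
          (\<forall>v\<in>vertices P. \<phi> {v} = {X v}))"

lemma vertex_face_of: "v \<in> vertices P \<Longrightarrow> {v} face_of P"
  by (simp add: vertices_def face_of_singleton)

lemma lattice_iso_sgn_lift:
  assumes \<phi>: "lattice_iso \<phi> L (spherical_faces (sgn ` Q))" and poly: "polyhedron Q"
    and a: "\<And>x. x \<in> Q \<Longrightarrow> a \<bullet> x = 1"
  obtains \<psi> where "lattice_iso \<psi> L (faces Q)" "\<And>F x. F \<in> L \<Longrightarrow> x \<in> Q \<Longrightarrow> \<phi> F = {sgn x} \<Longrightarrow> \<psi> F = {x}"
proof
  let ?\<psi> = "inv_into (faces Q) (image sgn) \<circ> \<phi>"
  have sgn_iso: "lattice_iso (image sgn) (faces Q) (spherical_faces (sgn ` Q))"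
    using poly a by (rule lattice_iso_sgn_faces)
  show iso: "lattice_iso ?\<psi> L (faces Q)"
    by (rule lattice_iso_comp[OF \<phi> lattice_iso_inv_into[OF sgn_iso]])
  fix F x assume F: "F \<in> L" and x: "x \<in> Q" "\<phi> F = {sgn x}"
  have image: "sgn ` ?\<psi> F = sgn ` {x}"
    using bij_betw_inv_into_right[OF lattice_isoD(1)[OF sgn_iso] lattice_isoD(2)[OF \<phi> F]] x(2)
    by simp
  have "?\<psi> F face_of Q" using lattice_isoD(2)[OF iso F] by (simp only: faces_def mem_Collect_eq)
  moreover have "inj_on sgn Q" using a by (rule inj_on_sgn_hyperplane)
  ultimately show "?\<psi> F = {x}"
    using inj_on_image_eq_iff face_of_imp_subset image x(1) by (metis empty_subsetI insert_subset)
qed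

lemma realization_space_gnomonic:
  fixes P :: "'a::euclidean_space set"
  assumes P: "polytope P" and V: "V \<in> realization_space P"
  obtains a where "\<And>v. v \<in> vertices P \<Longrightarrow> a \<bullet> V v > 0" "labelled_realization P (\<lambda>v. gnomonic a (V v))"
proof -
  let ?S = "V ` vertices P"
  obtain \<phi> where \<phi>: "lattice_iso \<phi> (faces P) (spherical_faces (spherical_hull ?S))"
      and label: "\<And>v. v \<in> vertices P \<Longrightarrow> \<phi> {v} = {V v}"
    using V by (auto simp: realization_space_def)
  have "in_open_hemisphere ?S" using V by (simp add: realization_space_def)
  then obtain a where unit: "?S \<subseteq> sphere 0 1" and a: "\<And>x. x \<in> ?S \<Longrightarrow> a \<bullet> x > 0"
    unfolding in_open_hemisphere_def by blast
  define Q where "Q = convex hull (gnomonic a ` ?S)"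
  have Q: "sgn ` Q = spherical_hull ?S"
    unfolding Q_def using a by (rule sgn_image_convex_hull_gnomonic)
  have Q1: "a \<bullet> x = 1" if "x \<in> Q" for x
    using inner_convex_hull_gnomonic[OF a] that by (auto simp: Q_def)
  have "polyhedron Q"
    unfolding Q_def
    using finite_vertices[OF P] by (intro polytope_imp_polyhedron polytope_convex_hull) simp
  then obtain \<psi> where \<psi>: "lattice_iso \<psi> (faces P) (faces Q)"
      and lift: "\<And>F x. F \<in> faces P \<Longrightarrow> x \<in> Q \<Longrightarrow> \<phi> F = {sgn x} \<Longrightarrow> \<psi> F = {x}"
    using lattice_iso_sgn_lift[OF \<phi>[folded Q] _ Q1] by blast
  have "\<psi> {v} = {gnomonic a (V v)}" if v: "v \<in> vertices P" for v
  proof (rule lift)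
    show "{v} \<in> faces P" using vertex_face_of[OF v] by (simp add: faces_def)
    show "gnomonic a (V v) \<in> Q" using v by (simp add: Q_def hull_inc)
    have "norm (V v) = 1" "a \<bullet> V v > 0" using unit a v by auto
    then have "sgn (gnomonic a (V v)) = V v" by (simp only: sgn_gnomonic) (simp add: sgn_div_norm)
    then show "\<phi> {v} = {sgn (gnomonic a (V v))}" using label[OF v] by simp
  qed
  then have "labelled_realization P (\<lambda>v. gnomonic a (V v))"
    using \<psi> unfolding labelled_realization_def Q_def image_image by blast
  then show thesis using that a by blast
qed

context
  fixes P :: "'a::euclidean_space set" and X :: "'a \<Rightarrow> 'b::euclidean_space"
  assumes P: "polytope P" and X: "labelled_realization P X"
begin

lemma labelled_realization_face:
  assumes F: "F face_of P"
  shows "convex hull (X ` (vertices P \<inter> F)) face_of convex hull (X ` vertices P)"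
    and "aff_dim (X ` (vertices P \<inter> F)) = aff_dim F"
    and "v \<in> vertices P \<Longrightarrow> X v \<in> affine hull (X ` (vertices P \<inter> F)) \<longleftrightarrow> v \<in> F"
proof -
  let ?Q = "convex hull (X ` vertices P)"
  obtain \<phi>
    where iso: "lattice_iso \<phi> (faces P) (faces ?Q)" and label: "\<And>v. v \<in> vertices P \<Longrightarrow> \<phi> {v} = {X v}"
    using X by (auto simp: labelled_realization_def)
  have \<phi>F: "\<phi> F face_of ?Q" using lattice_isoD(2)[OF iso] F by (simp add: faces_def)
  have mem: "X v \<in> \<phi> F \<longleftrightarrow> v \<in> F" if "v \<in> vertices P" for v
    using lattice_isoD(3)[OF iso, of "{v}" F] vertex_face_of[OF that] label[OF that] F
    by (simp add: faces_def)
  have fin: "finite (X ` vertices P)" using finite_vertices[OF P] by simp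
  have "X ` vertices P \<inter> \<phi> F = X ` (vertices P \<inter> F)" using mem by auto
  then have hull: "\<phi> F = convex hull (X ` (vertices P \<inter> F))"
    using face_of_convex_hull_eq[OF fin \<phi>F] by simp
  show face: "convex hull (X ` (vertices P \<inter> F)) face_of ?Q" using \<phi>F hull by simp
  show "aff_dim (X ` (vertices P \<inter> F)) = aff_dim F"
    using lattice_iso_faces_aff_dim[OF P polytope_convex_hull[OF fin] iso F] hull
    by (simp add: aff_dim_convex_hull)
  show "X v \<in> affine hull (X ` (vertices P \<inter> F)) \<longleftrightarrow> v \<in> F" if v: "v \<in> vertices P"
  proof -
    have "\<phi> F = affine hull (\<phi> F) \<inter> ?Q" using face_of_imp_eq_affine_Int[OF _ \<phi>F] by simp
    moreover have "X v \<in> ?Q" using v by (simp add: hull_inc)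
    ultimately have "X v \<in> affine hull (\<phi> F) \<longleftrightarrow> X v \<in> \<phi> F" by blast
    then show ?thesis using mem[OF v] hull by simp
  qed
qed

lemma labelled_realization_extreme_point:
  assumes "v \<in> vertices P"
  shows "X v extreme_point_of convex hull (X ` vertices P)"
proof -
  have "vertices P \<inter> {v} = {v}" using assms by auto
  then show ?thesis
    using labelled_realization_face(1)[OF vertex_face_of[OF assms]] by (simp add: face_of_singleton)
qed

lemma inj_on_labelled_realization: "inj_on X (vertices P)"
proof
  fix u v assume uv: "u \<in> vertices P" "v \<in> vertices P" "X u = X v"
  have "X u \<in> affine hull (X ` (vertices P \<inter> {v}))" using uv by (intro hull_inc) auto
  then show "u = v" using labelled_realization_face(3)[OF vertex_face_of[OF uv(2)] uv(1)] by simp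
qed

end

lemma realization_space_norm_eq_1: "V \<in> realization_space P \<Longrightarrow> v \<in> vertices P \<Longrightarrow> norm (V v) = 1"
  by (auto simp: realization_space_def PiE_iff)

context
  fixes P :: "'a::euclidean_space set" and V :: "'a \<Rightarrow> 'a \<times> real"
  assumes P: "polytope P" and V: "V \<in> realization_space P"
begin

lemma realization_space_dim_face:
  assumes "F face_of P"
  shows "int (dim (V ` (vertices P \<inter> F))) = aff_dim F + 1"
proof -
  obtain a
    where a: "\<And>v. v \<in> vertices P \<Longrightarrow> a \<bullet> V v > 0"
      and X: "labelled_realization P (\<lambda>v. gnomonic a (V v))"
    using realization_space_gnomonic[OF P V] by blast
  have "int (dim (V ` (vertices P \<inter> F))) = aff_dim (gnomonic a ` V ` (vertices P \<inter> F)) + 1"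
    using finite_vertices[OF P] a by (subst aff_dim_gnomonic_image) auto
  then show ?thesis using labelled_realization_face(2)[OF P X assms] by (simp add: image_image)
qed

lemma realization_space_in_span_face_iff:
  assumes "F face_of P" "v \<in> vertices P"
  shows "V v \<in> span (V ` (vertices P \<inter> F)) \<longleftrightarrow> v \<in> F"
proof -
  obtain a
    where a: "\<And>v. v \<in> vertices P \<Longrightarrow> a \<bullet> V v > 0"
      and X: "labelled_realization P (\<lambda>v. gnomonic a (V v))"
    using realization_space_gnomonic[OF P V] by blast
  have "V v \<in> span (V ` (vertices P \<inter> F)) \<longleftrightarrow>
      gnomonic a (V v) \<in> affine hull (gnomonic a ` V ` (vertices P \<inter> F))"
    using finite_vertices[OF P] a assms(2) by (subst gnomonic_in_affine_hull_iff) auto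
  then show ?thesis using labelled_realization_face(3)[OF P X assms] by (simp add: image_image)
qed

lemma realization_space_notin_span_pair:
  assumes W: "u \<in> vertices P" "v \<in> vertices P" "w \<in> vertices P" and ne: "u \<noteq> v" "u \<noteq> w" "v \<noteq> w"
  shows "V u \<notin> span {V v, V w}"
proof -
  obtain a
    where a: "\<And>v. v \<in> vertices P \<Longrightarrow> a \<bullet> V v > 0"
      and X: "labelled_realization P (\<lambda>v. gnomonic a (V v))"
    using realization_space_gnomonic[OF P V] by blast
  have "gnomonic a (V u) \<notin> affine hull {gnomonic a (V v), gnomonic a (V w)}"
    using labelled_realization_extreme_point[OF P X]
      inj_on_eq_iff[OF inj_on_labelled_realization[OF P X]] W ne
    by (intro extreme_point_notin_affine_hull_pair[where
          P = "convex hull ((\<lambda>v. gnomonic a (V v)) ` vertices P)"]) auto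
  moreover have "gnomonic a (V u) \<in> affine hull (gnomonic a ` {V v, V w}) \<longleftrightarrow> V u \<in> span {V v, V w}"
    using a W by (intro gnomonic_in_affine_hull_iff) blast+
  ultimately show ?thesis by simp
qed

end

section \<open>Realizations of cubical corners\<close>

definition vertex_set_of_2face :: "'a::euclidean_space set \<Rightarrow> 'a set \<Rightarrow> bool" where
  "vertex_set_of_2face P Q \<longleftrightarrow> (\<exists>F. F face_of P \<and> vertices P \<inter> F = Q \<and> aff_dim F \<le> 2)"

definition cubical_corner :: "'a::euclidean_space set \<Rightarrow> 'a \<Rightarrow> 'a \<Rightarrow> 'a \<Rightarrow> 'a \<Rightarrow> 'a \<Rightarrow> 'a \<Rightarrow> 'a \<Rightarrow> bool"
  where "cubical_corner P w u1 u2 u3 z12 z13 z23 \<longleftrightarrow>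
     vertex_set_of_2face P {w, u1, u2, z12} \<and> vertex_set_of_2face P {w, u1, u3, z13} \<and>
     vertex_set_of_2face P {w, u2, u3, z23} \<and> distinct [w, u1, u2, u3, z12, z13, z23]"

inductive_set corner_closure :: "'a::euclidean_space set \<Rightarrow> 'a set \<Rightarrow> 'a set" for P T where
  seed: "v \<in> T \<Longrightarrow> v \<in> corner_closure P T"
| corner: "cubical_corner P w u1 u2 u3 z12 z13 z23 \<Longrightarrow>
    \<forall>v\<in>{u1, u2, u3, z12, z13, z23}. v \<in> corner_closure P T \<Longrightarrow> w \<in> corner_closure P T"

lemma in_span_if_in_span_insert:
  fixes y :: "'a::real_vector"
  assumes "y \<in> span (insert a A)" "y \<in> span B" "A \<subseteq> B" "a \<notin> span B"
  shows "y \<in> span A"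
proof (rule ccontr)
  assume "y \<notin> span A"
  then have "a \<in> span (insert y A)" using assms(1) by (rule in_span_insert[rotated])
  moreover have "span (insert y A) \<subseteq> span B"
    using assms(2,3) by (intro span_minimal) (auto intro: span_base)
  ultimately show False using assms(4) by auto
qed

context
  fixes P :: "'a::euclidean_space set"
  assumes P: "polytope P"
begin

lemma realization_2face_notin_span:
  assumes V: "V \<in> realization_space P" and Q: "vertex_set_of_2face P Q"
    and "v \<in> vertices P" "v \<notin> Q"
  shows "V v \<notin> span (V ` Q)"
proof -
  obtain F where "F face_of P" "vertices P \<inter> F = Q" using Q by (auto simp: vertex_set_of_2face_def)
  then show ?thesis using realization_space_in_span_face_iff[OF P V, of F v] assms by blast
qed

lemma realization_2face_in_span:
  assumes V: "V \<in> realization_space P" and face: "vertex_set_of_2face P {w, x, y, z}"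
    and ne: "x \<noteq> y" "x \<noteq> z" "y \<noteq> z"
  shows "V w \<in> span {V x, V y, V z}"
proof -
  obtain F where F: "F face_of P" "vertices P \<inter> F = {w, x, y, z}" "aff_dim F \<le> 2"
    using face by (auto simp: vertex_set_of_2face_def)
  then have vert: "x \<in> vertices P" "y \<in> vertices P" "z \<in> vertices P" by auto
  have notin: "V x \<notin> span {V y, V z}" "V y \<notin> span {V x, V z}" "V z \<notin> span {V x, V y}"
    using realization_space_notin_span_pair[OF P V] vert ne by auto
  have "V y \<notin> span {V z}" using notin(2) span_mono[of "{V z}" "{V x, V z}"] by auto
  moreover have "V z \<noteq> 0" using notin(3) span_zero by metis
  ultimately have ind: "independent {V x, V y, V z}"
    using notin(1) by (auto simp: independent_insert span_base)
  have "V x \<noteq> V y" "V x \<noteq> V z" "V y \<noteq> V z" using notin by (auto intro: span_base)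
  then have "card {V x, V y, V z} = 3" by simp
  moreover have "dim (V ` {w, x, y, z}) \<le> 3"
    using realization_space_dim_face[OF P V F(1)] F(2,3) by simp
  ultimately have "V ` {w, x, y, z} \<subseteq> span {V x, V y, V z}"
    using ind by (intro card_ge_dim_independent) auto
  then show ?thesis by simp
qed

lemma realizations_2face_in_span:
  assumes V: "V \<in> realization_space P" and V': "V' \<in> realization_space P"
    and face: "vertex_set_of_2face P {w, x, y, z}" and dist: "distinct [w, x, y, z]"
    and agree: "V' x = V x" "V' y = V y" "V' z = V z"
  shows "V' w \<in> span {V w, V x, V y}"
proof -
  have "{z, w, x, y} = {w, x, y, z}" by auto
  then have "V z \<in> span {V w, V x, V y}"
    using face dist by (intro realization_2face_in_span[OF V]) auto
  then have "span {V x, V y, V z} \<subseteq> span {V w, V x, V y}"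
    by (intro span_minimal) (auto intro: span_base)
  moreover have "V' w \<in> span {V' x, V' y, V' z}"
    using dist by (intro realization_2face_in_span[OF V' face]) auto
  ultimately show ?thesis using agree by auto
qed

text \<open>The planes of the three 2-faces at \<open>w\<close> meet only in \<open>w\<close>.\<close>

lemma realizations_cubical_corner_in_span:
  assumes V: "V \<in> realization_space P" and V': "V' \<in> realization_space P"
    and corner: "cubical_corner P w u1 u2 u3 z12 z13 z23"
    and agree: "\<forall>v\<in>{u1, u2, u3, z12, z13, z23}. V' v = V v"
  shows "V' w \<in> span {V w}"
proof -
  have f12: "vertex_set_of_2face P {w, u1, u2, z12}"
    and f13: "vertex_set_of_2face P {w, u1, u3, z13}"
    and f23: "vertex_set_of_2face P {w, u2, u3, z23}"
    and dist: "distinct [w, u1, u2, u3, z12, z13, z23]"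
    using corner by (auto simp: cubical_corner_def)
  have w12: "V' w \<in> span {V w, V u1, V u2}"
    using realizations_2face_in_span[OF V V' f12] dist agree by auto
  have w13: "V' w \<in> span {V w, V u1, V u3}"
    using realizations_2face_in_span[OF V V' f13] dist agree by auto
  have w23: "V' w \<in> span {V w, V u2, V u3}"
    using realizations_2face_in_span[OF V V' f23] dist agree by auto
  have vert: "u1 \<in> vertices P" "u3 \<in> vertices P" using f13 by (auto simp: vertex_set_of_2face_def)
  have u3: "V u3 \<notin> span {V w, V u1, V u2}"
    using realization_2face_notin_span[OF V f12 vert(2)]
      span_mono[of "{V w, V u1, V u2}" "V ` {w, u1, u2, z12}"] dist
    by auto
  have u1: "V u1 \<notin> span {V w, V u2, V u3}"
    using realization_2face_notin_span[OF V f23 vert(1)]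
      span_mono[of "{V w, V u2, V u3}" "V ` {w, u2, u3, z23}"] dist
    by auto
  have "{V w, V u1, V u3} = insert (V u3) {V w, V u1}" by auto
  then have "V' w \<in> span {V w, V u1}"
    using in_span_if_in_span_insert[of "V' w" "V u3" "{V w, V u1}" "{V w, V u1, V u2}"] w13 w12 u3
    by auto
  moreover have "{V w, V u1} = insert (V u1) {V w}" by auto
  ultimately show ?thesis
    using in_span_if_in_span_insert[of "V' w" "V u1" "{V w}" "{V w, V u2, V u3}"] w23 u1 by auto
qed

lemma realization_corner_closure_in_span:
  assumes V: "V \<in> realization_space P" and "x \<in> corner_closure P T"
  shows "V x \<in> span (V ` T)"
  using assms(2)
proof induction
  case (seed v)
  then show ?case by (intro span_base) auto
next
  case (corner w u1 u2 u3 z12 z13 z23)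
  then have "V w \<in> span {V u1, V u2, V z12}"
    by (intro realization_2face_in_span[OF V]) (auto simp: cubical_corner_def)
  moreover have "span {V u1, V u2, V z12} \<subseteq> span (V ` T)"
    using corner.IH by (intro span_minimal) auto
  ultimately show ?case by blast
qed

lemma realizations_eq_on_corner_closure:
  assumes V: "V \<in> realization_space P" and V': "V' \<in> realization_space P"
    and agree: "\<And>v. v \<in> T \<Longrightarrow> V' v = V v"
    and not_antipodal: "\<And>v. v \<in> vertices P \<Longrightarrow> V' v \<noteq> - V v"
    and "x \<in> corner_closure P T"
  shows "V' x = V x"
  using assms(5)
proof induction
  case (seed v)
  then show ?case by (rule agree)
next
  case (corner w u1 u2 u3 z12 z13 z23)
  have w: "w \<in> vertices P"
    using corner.hyps by (auto simp: cubical_corner_def vertex_set_of_2face_def)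
  have "V' w \<in> span {V w}"
    using realizations_cubical_corner_in_span[OF V V' corner.hyps] corner.IH by blast
  then obtain c where scale: "V' w = c *\<^sub>R V w" by (auto simp: span_singleton)
  then have "\<bar>c\<bar> = 1"
    using realization_space_norm_eq_1[OF V w] realization_space_norm_eq_1[OF V' w] by simp
  moreover have "c \<noteq> - 1" using scale not_antipodal[OF w] by auto
  ultimately show ?case using scale by (auto simp: abs_if split: if_splits)
qed

end

section \<open>Dimension bounds from local coordinates\<close>

lemma Euclidean_space_injection_imp_le:
  assumes U: "openin (Euclidean_space k) U" "U \<noteq> {}"
    and f: "continuous_on U f" "inj_on f U" "\<And>x i. x \<in> U \<Longrightarrow> i \<ge> D \<Longrightarrow> f x i = (0::real)"
  shows "k \<le> D"
proof (rule ccontr)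
  assume "\<not> k \<le> D"
  then have "D < k" by simp
  have U0: "U \<subseteq> {x. \<forall>i\<ge>k. x i = 0}"
    using openin_subset[OF U(1)] by (simp add: topspace_Euclidean_space)
  have "continuous_map (subtopology (Euclidean_space k) U) (Euclidean_space k) f"
    unfolding Euclidean_space_def euclidean_product_topology continuous_map_in_subtopology
      subtopology_subtopology
    using f(1,3) \<open>D < k\<close> U0
    by (auto simp: continuous_map_iff_continuous intro: continuous_on_subset)
  then have "openin (Euclidean_space k) (f ` U)"
    by (rule invariance_of_domain_Euclidean_space[OF U(1) _ f(2)])
  then obtain W where W: "open W" "f ` U = W \<inter> {x. \<forall>i\<ge>k. x i = 0}"
    by (auto simp: Euclidean_space_def euclidean_product_topology openin_subtopology)
  obtain x where x: "x \<in> U" using U by auto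
  define \<gamma> where "\<gamma> t = (\<lambda>i. if i = D then t else f x i)" for t :: real
  have "continuous_on UNIV \<gamma>"
    unfolding \<gamma>_def
  proof (rule continuous_on_coordinatewise_then_product)
    show "continuous_on UNIV (\<lambda>t. if i = D then t else f x i)" for i
      by (cases "i = D") (auto intro: continuous_intros)
  qed
  then have "open (\<gamma> -` W)" using W(1) by (simp add: continuous_on_open_vimage)
  moreover have "0 \<in> \<gamma> -` W"
  proof -
    have "\<gamma> 0 = f x" using f(3)[OF x, of D] by (auto simp: \<gamma>_def)
    then show ?thesis using W(2) x by auto
  qed
  ultimately obtain e where e: "e > 0" "ball 0 e \<subseteq> \<gamma> -` W" by (meson open_contains_ball)
  have "e / 2 \<in> ball 0 e" using e by simp
  then have "\<gamma> (e / 2) \<in> W" using e(2) by blast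
  moreover have "\<gamma> (e / 2) i = 0" if "i \<ge> k" for i
    using that \<open>D < k\<close> f(3)[OF x, of i] by (simp add: \<gamma>_def)
  ultimately have "\<gamma> (e / 2) \<in> f ` U" using W(2) by simp
  then have "\<gamma> (e / 2) D = 0" using f(3) by auto
  then show False using e by (simp add: \<gamma>_def)
qed

lemma continuous_on_restrict: "continuous_on S (\<lambda>y. restrict y I :: 'i \<Rightarrow> 'a::topological_space)"
proof (rule continuous_on_coordinatewise_then_product)
  show "continuous_on S (\<lambda>y. restrict y I i :: 'a)" for i
    by (cases "i \<in> I") (simp_all add: continuous_on_subset[OF continuous_on_product_coordinates])
qed

lemma openin_Euclidean_space_restrict_vimage:
  assumes "open S"
  shows "openin (Euclidean_space k)
    ((\<lambda>y. restrict y {..<k}) -` (S \<inter> open_cube k) \<inter> {y. \<forall>i\<ge>k. y i = 0})"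
proof -
  let ?r = "\<lambda>y :: nat \<Rightarrow> real. restrict y {..<k}"
  have "?r -` open_cube k = (\<Inter>i<k. (\<lambda>y. y i) -` {0<..<1})" by (auto simp: open_cube_def PiE_iff)
  then have "open (?r -` open_cube k)" by (simp add: open_INT open_vimage)
  moreover have "open (?r -` S)" using assms continuous_on_restrict by (rule open_vimage)
  ultimately have "open (?r -` (S \<inter> open_cube k))" unfolding vimage_Int by (rule open_Int[rotated])
  then show ?thesis
    by (auto simp: Euclidean_space_def euclidean_product_topology openin_subtopology)
qed

lemma open_cube_injection_imp_le:
  assumes "open S" "S \<inter> open_cube k \<noteq> {}"
    and h: "continuous_on (S \<inter> open_cube k) h" "inj_on h (S \<inter> open_cube k)"
      "\<And>x i. x \<in> S \<inter> open_cube k \<Longrightarrow> i \<ge> D \<Longrightarrow> h x i = (0::real)"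
  shows "k \<le> D"
proof -
  define r :: "(nat \<Rightarrow> real) \<Rightarrow> nat \<Rightarrow> real" where "r = (\<lambda>y. restrict y {..<k})"
  define U where "U = r -` (S \<inter> open_cube k) \<inter> {y. \<forall>i\<ge>k. y i = 0}"
  have U_open: "openin (Euclidean_space k) U"
    unfolding U_def r_def using \<open>open S\<close> by (rule openin_Euclidean_space_restrict_vimage)
  have rU: "r ` U \<subseteq> S \<inter> open_cube k" by (auto simp: U_def)
  have "inj_on r U"
  proof
    fix y z assume yz: "y \<in> U" "z \<in> U" "r y = r z"
    have "y i = z i" for i
      using fun_cong[OF yz(3), of i] yz(1,2) by (cases "i < k") (auto simp: r_def U_def)
    then show "y = z" by (rule ext)
  qed
  then have "inj_on (h \<circ> r) U" using inj_on_subset[OF h(2) rU] by (rule comp_inj_on)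
  moreover have "continuous_on U (h \<circ> r)"
    unfolding r_def
    by (intro continuous_on_compose continuous_on_restrict
        continuous_on_subset[OF h(1) rU[unfolded r_def]])
  moreover have "U \<noteq> {}"
  proof -
    obtain c where c: "c \<in> S \<inter> open_cube k" using assms(2) by blast
    then have "r (\<lambda>i. if i < k then c i else 0) = c"
      by (auto simp: r_def open_cube_def PiE_iff extensional_def)
    then have "(\<lambda>i. if i < k then c i else 0) \<in> U" using c by (simp add: U_def)
    then show ?thesis by blast
  qed
  moreover have "(h \<circ> r) x i = 0" if "x \<in> U" "i \<ge> D" for x i using h(3)[of "r x" i] rU that by auto
  ultimately show ?thesis using U_open by (intro Euclidean_space_injection_imp_le)
qed

definition locally_separated_by :: "nat \<Rightarrow> 'a::topological_space set \<Rightarrow> 'a \<Rightarrow> bool" where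
  "locally_separated_by D A x \<longleftrightarrow>
     (\<exists>U. \<exists>\<rho> :: nat \<Rightarrow> 'a \<Rightarrow> real. open U \<and> x \<in> U \<and> (\<forall>n<D. continuous_on (A \<inter> U) (\<rho> n)) \<and>
        (\<forall>y\<in>A \<inter> U. \<forall>z\<in>A \<inter> U. (\<forall>n<D. \<rho> n y = \<rho> n z) \<longrightarrow> y = z))"

lemma locally_separated_byI:
  fixes \<rho> :: "'k \<Rightarrow> 'a::topological_space \<Rightarrow> real"
  assumes "open U" "x \<in> U" "finite K" "card K \<le> D"
    and cont: "\<And>k. k \<in> K \<Longrightarrow> continuous_on (A \<inter> U) (\<rho> k)"
    and sep: "\<And>y z. y \<in> A \<inter> U \<Longrightarrow> z \<in> A \<inter> U \<Longrightarrow> (\<And>k. k \<in> K \<Longrightarrow> \<rho> k y = \<rho> k z) \<Longrightarrow> y = z"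
  shows "locally_separated_by D A x"
proof -
  obtain enum where enum: "bij_betw enum {0..<card K} K"
    using ex_bij_betw_nat_finite[OF \<open>finite K\<close>] by blast
  define \<sigma> where "\<sigma> n y = (if n < card K then \<rho> (enum n) y else 0)" for n y
  have "continuous_on (A \<inter> U) (\<sigma> n)" for n
    using cont bij_betw_apply[OF enum] by (cases "n < card K") (simp_all add: \<sigma>_def)
  moreover have "y = z" if "y \<in> A \<inter> U" "z \<in> A \<inter> U" and eq: "\<forall>n<D. \<sigma> n y = \<sigma> n z" for y z
  proof (rule sep[OF that(1,2)])
    fix k assume "k \<in> K"
    then have "k \<in> enum ` {0..<card K}" using bij_betw_imp_surj_on[OF enum] by simp
    then obtain n where "n < card K" "k = enum n" by auto
    then show "\<rho> k y = \<rho> k z" using spec[OF eq, of n] \<open>card K \<le> D\<close> by (simp add: \<sigma>_def)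
  qed
  ultimately show ?thesis
    unfolding locally_separated_by_def using assms(1,2) by blast
qed

lemma locally_separated_byE:
  assumes "locally_separated_by D A x"
  obtains U and \<Phi> :: "'a::topological_space \<Rightarrow> nat \<Rightarrow> real"
  where "open U" "x \<in> U" "continuous_on (A \<inter> U) \<Phi>" "inj_on \<Phi> (A \<inter> U)" "\<And>y i. i \<ge> D \<Longrightarrow> \<Phi> y i = 0"
proof -
  obtain U and \<rho> :: "nat \<Rightarrow> 'a \<Rightarrow> real" where U: "open U" "x \<in> U" "\<forall>n<D. continuous_on (A \<inter> U) (\<rho> n)"
    and sep: "\<forall>y\<in>A \<inter> U. \<forall>z\<in>A \<inter> U. (\<forall>n<D. \<rho> n y = \<rho> n z) \<longrightarrow> y = z"
    using assms unfolding locally_separated_by_def by blast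
  define \<Phi> where "\<Phi> y n = (if n < D then \<rho> n y else 0)" for y n
  have "continuous_on (A \<inter> U) \<Phi>"
  proof (rule continuous_on_coordinatewise_then_product)
    show "continuous_on (A \<inter> U) (\<lambda>y. \<Phi> y n)" for n
      using U(3) by (cases "n < D") (simp_all add: \<Phi>_def)
  qed
  moreover have "inj_on \<Phi> (A \<inter> U)"
  proof (rule inj_onI)
    fix y z assume yz: "y \<in> A \<inter> U" "z \<in> A \<inter> U" "\<Phi> y = \<Phi> z"
    have "\<rho> n y = \<rho> n z" if "n < D" for n using fun_cong[OF yz(3), of n] that by (simp add: \<Phi>_def)
    then show "y = z" using sep yz(1,2) by blast
  qed
  moreover have "\<Phi> y i = 0" if "i \<ge> D" for y i using that by (simp add: \<Phi>_def)
  ultimately show thesis using that U(1,2) by blast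
qed

text \<open>Of a cell's parametrization, only continuity and injectivity matter for the upper bound.\<close>

lemma semialgebraic_dim_le_if_locally_separated:
  fixes A :: "('j \<Rightarrow> real) set"
  assumes "\<And>x. x \<in> A \<Longrightarrow> locally_separated_by D A x"
  shows "semialgebraic_dim J A \<le> ereal (real D)"
  unfolding semialgebraic_dim_def
proof (rule SUP_least, safe)
  fix k assume "contains_open_cell J A k"
  then obtain f g
    where fA: "f ` open_cube k \<subseteq> A" and hom: "homeomorphism (open_cube k) (f ` open_cube k) f g"
    by (auto simp: contains_open_cell_def)
  have f_cont: "continuous_on (open_cube k) f" and f_inj: "inj_on f (open_cube k)"
    using hom by (auto simp: homeomorphism_def intro: inj_on_inverseI)
  obtain c where c: "c \<in> open_cube k"
  proof
    show "(\<lambda>i\<in>{..<k}. 1/2) \<in> open_cube k" by (auto simp: open_cube_def)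
  qed
  then have "locally_separated_by D A (f c)" using fA by (intro assms) auto
  then obtain U \<Phi> where U: "open U" "f c \<in> U"
    and \<Phi>: "continuous_on (A \<inter> U) \<Phi>" "inj_on \<Phi> (A \<inter> U)" "\<And>y i. i \<ge> D \<Longrightarrow> \<Phi> y i = (0::real)"
    by (elim locally_separated_byE) blast
  obtain S where S: "open S" "S \<inter> open_cube k = f -` U \<inter> open_cube k"
    using f_cont U(1) unfolding continuous_on_open_invariant by blast
  have im: "f ` (S \<inter> open_cube k) \<subseteq> A \<inter> U" unfolding S(2) using fA by auto
  have "continuous_on (S \<inter> open_cube k) (\<Phi> \<circ> f)"
    using f_cont im \<Phi>(1) by (metis continuous_on_compose continuous_on_subset inf_le2)
  moreover have "inj_on (\<Phi> \<circ> f) (S \<inter> open_cube k)"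
    using comp_inj_on[OF inj_on_subset[OF f_inj] inj_on_subset[OF \<Phi>(2) im]] by blast
  moreover have "S \<inter> open_cube k \<noteq> {}" unfolding S(2) using c U(2) by blast
  moreover have "(\<Phi> \<circ> f) x i = 0" if "i \<ge> D" for x i using \<Phi>(3)[OF that] by simp
  ultimately have "k \<le> D" by (intro open_cube_injection_imp_le[OF S(1)])
  then show "ereal (real k) \<le> ereal (real D)" by simp
qed

section \<open>Spaces of unit vector configurations\<close>

definition separates :: "'a::real_inner set \<Rightarrow> 'a set \<Rightarrow> bool" where
  "separates Q S \<longleftrightarrow> (\<forall>y\<in>S. (\<forall>q\<in>Q. q \<bullet> y = 0) \<longrightarrow> y = 0)"

definition proportional_on :: "'a::real_inner set \<Rightarrow> 'a \<Rightarrow> 'a \<Rightarrow> bool" where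
  "proportional_on Q x y \<longleftrightarrow> (\<exists>c>0. \<forall>q\<in>Q. q \<bullet> y = c * (q \<bullet> x))"

lemma separates_Basis: "separates Basis S"
  unfolding separates_def by (metis euclidean_all_zero_iff inner_commute)

lemma unit_vectors_eq_if_proportional_on:
  assumes "subspace S" "separates Q S" "x \<in> S" "y \<in> S" "norm x = 1" "norm y = 1"
    "proportional_on Q x y"
  shows "x = y"
proof -
  obtain c where factor: "c > 0" "\<And>q. q \<in> Q \<Longrightarrow> q \<bullet> y = c * (q \<bullet> x)"
    using assms(7) by (auto simp: proportional_on_def)
  have "y - c *\<^sub>R x \<in> S" using assms(1,3,4) by (intro subspace_diff subspace_scale)
  moreover have "q \<bullet> (y - c *\<^sub>R x) = 0" if "q \<in> Q" for q
    using factor(2)[OF that] by (simp add: inner_diff_right)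
  ultimately have "y - c *\<^sub>R x = 0" using assms(2) unfolding separates_def by blast
  then have "y = c *\<^sub>R x" by simp
  then show ?thesis using factor(1) assms(5,6) by simp
qed

lemma proportional_on_if_ratios_eq:
  assumes "(p \<bullet> x) * r > 0" "(p \<bullet> y) * r > 0"
    and ratio: "\<And>q. q \<in> Q - {p} \<Longrightarrow> (q \<bullet> x) / (p \<bullet> x) = (q \<bullet> y) / (p \<bullet> y)"
  shows "proportional_on Q x y"
  unfolding proportional_on_def
proof (intro exI[of _ "(p \<bullet> y) / (p \<bullet> x)"] conjI ballI)
  show "0 < (p \<bullet> y) / (p \<bullet> x)"
    using assms(1,2) by (auto simp: zero_less_mult_iff zero_less_divide_iff)
  have nonzero: "p \<bullet> x \<noteq> 0" "p \<bullet> y \<noteq> 0" using assms(1,2) by auto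
  show "q \<bullet> y = (p \<bullet> y) / (p \<bullet> x) * (q \<bullet> x)" if "q \<in> Q" for q
    using ratio[of q] nonzero that by (cases "q = p") (simp_all add: field_simps)
qed

lemma strictly_diagonally_dominant_kernel:
  fixes a :: "'i \<Rightarrow> 'i \<Rightarrow> real"
  assumes fin: "finite I" and dom: "\<And>j. j \<in> I \<Longrightarrow> (\<Sum>i\<in>I - {j}. \<bar>a j i\<bar>) < \<bar>a j j\<bar>"
    and zero: "\<And>j. j \<in> I \<Longrightarrow> (\<Sum>i\<in>I. c i * a j i) = 0" and "i \<in> I"
  shows "c i = 0"
proof -
  have "Max ((\<lambda>i. \<bar>c i\<bar>) ` I) \<in> (\<lambda>i. \<bar>c i\<bar>) ` I" using fin \<open>i \<in> I\<close> by (intro Max_in) auto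
  then obtain j where j: "j \<in> I" "Max ((\<lambda>i. \<bar>c i\<bar>) ` I) = \<bar>c j\<bar>" by auto
  have max: "\<bar>c k\<bar> \<le> \<bar>c j\<bar>" if "k \<in> I" for k
    using fin that unfolding j(2)[symmetric] by (intro Max_ge) auto
  have "c j * a j j = - (\<Sum>i\<in>I - {j}. c i * a j i)"
    using zero[OF j(1)] sum.remove[OF fin j(1), of "\<lambda>i. c i * a j i"] by simp
  then have "\<bar>c j\<bar> * \<bar>a j j\<bar> = \<bar>\<Sum>i\<in>I - {j}. c i * a j i\<bar>" by (simp flip: abs_mult)
  also have "\<dots> \<le> (\<Sum>i\<in>I - {j}. \<bar>c i * a j i\<bar>)" by (rule sum_abs)
  also have "\<dots> \<le> (\<Sum>i\<in>I - {j}. \<bar>c j\<bar> * \<bar>a j i\<bar>)"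
    using max by (intro sum_mono) (auto simp: abs_mult intro: mult_right_mono)
  also have "\<dots> = \<bar>c j\<bar> * (\<Sum>i\<in>I - {j}. \<bar>a j i\<bar>)" by (simp add: sum_distrib_left)
  finally have "c j = 0" using dom[OF j(1)] by (auto simp: mult_le_cancel_left)
  then show ?thesis using max[OF \<open>i \<in> I\<close>] by simp
qed

definition dominant_pairing :: "'i set \<Rightarrow> ('i \<Rightarrow> 'a::real_inner) \<Rightarrow> ('i \<Rightarrow> 'a) \<Rightarrow> bool" where
  "dominant_pairing I w f \<longleftrightarrow> (\<forall>j\<in>I. (\<Sum>i\<in>I - {j}. \<bar>w j \<bullet> f i\<bar>) < w j \<bullet> f j)"

lemma dominant_pairing_exists:
  fixes f :: "'i \<Rightarrow> 'a::euclidean_space"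
  assumes inj: "inj_on f I" and ind: "independent (f ` I)"
  obtains w where "inj_on w I" "dominant_pairing I w f"
proof -
  have "\<exists>w. w \<bullet> f j > 0 \<and> (\<forall>i\<in>I - {j}. w \<bullet> f i = 0)" if j: "j \<in> I" for j
  proof -
    let ?S = "f ` (I - {j})"
    obtain y z where yz: "y \<in> span ?S" "\<And>u. u \<in> span ?S \<Longrightarrow> orthogonal z u" "f j = y + z"
      using orthogonal_subspace_decomp_exists[of ?S "f j"] by metis
    have "f ` I - {f j} = ?S" using inj j by (auto simp: inj_on_def)
    then have "f j \<notin> span ?S" using ind j by (metis dependent_def imageI)
    then have "z \<noteq> 0" using yz by auto
    moreover have "z \<bullet> f j = z \<bullet> z" using yz by (simp add: inner_add_right orthogonal_def)
    moreover have "z \<bullet> f i = 0" if "i \<in> I - {j}" for i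
      using yz(2)[of "f i"] that by (auto simp: orthogonal_def intro: span_base)
    ultimately show ?thesis by (intro exI[of _ z]) auto
  qed
  then obtain w where w: "\<And>j. j \<in> I \<Longrightarrow> w j \<bullet> f j > 0" "\<And>i j. j \<in> I \<Longrightarrow> i \<in> I - {j} \<Longrightarrow> w j \<bullet> f i = 0"
    by metis
  have "inj_on w I"
  proof (rule inj_onI, rule ccontr)
    fix i j assume "i \<in> I" "j \<in> I" "w i = w j" "i \<noteq> j"
    then show False using w(1)[of i] w(2)[of j i] by simp
  qed
  moreover have "dominant_pairing I w f" unfolding dominant_pairing_def using w by simp
  ultimately show thesis using that by blast
qed

context
  fixes I :: "'i set" and w f :: "'i \<Rightarrow> 'a::euclidean_space"
  assumes fin: "finite I" and dom: "dominant_pairing I w f"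
begin

lemma dominant_pairing_coeffs_zero:
  assumes "\<And>j. j \<in> I \<Longrightarrow> w j \<bullet> (\<Sum>i\<in>I. c i *\<^sub>R f i) = 0" "i \<in> I"
  shows "c i = 0"
proof (rule strictly_diagonally_dominant_kernel[OF fin _ _ \<open>i \<in> I\<close>])
  fix j assume "j \<in> I"
  then show "(\<Sum>i\<in>I - {j}. \<bar>w j \<bullet> f i\<bar>) < \<bar>w j \<bullet> f j\<bar>"
    using dom by (force simp: dominant_pairing_def)
  show "(\<Sum>i\<in>I. c i * (w j \<bullet> f i)) = 0" using assms(1)[OF \<open>j \<in> I\<close>] by (simp add: inner_sum_right)
qed

lemma dominant_pairing_inj_on: "inj_on f I"
proof (rule inj_onI, rule ccontr)
  fix i j assume ij: "i \<in> I" "j \<in> I" "f i = f j" "i \<noteq> j"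
  have "\<bar>w j \<bullet> f i\<bar> \<le> (\<Sum>i\<in>I - {j}. \<bar>w j \<bullet> f i\<bar>)" using fin ij by (intro member_le_sum) auto
  also have "\<dots> < w j \<bullet> f j" using dom ij(2) by (simp add: dominant_pairing_def)
  finally show False using ij(3) by simp
qed

lemma dominant_pairing_independent: "independent (f ` I)"
proof (rule independent_if_scalars_zero)
  show "finite (f ` I)" using fin by simp
  fix u x assume u: "(\<Sum>x\<in>f ` I. u x *\<^sub>R x) = 0" and "x \<in> f ` I"
  then obtain i where i: "i \<in> I" "x = f i" by auto
  have "(\<Sum>i\<in>I. u (f i) *\<^sub>R f i) = 0" using u by (simp add: sum.reindex[OF dominant_pairing_inj_on])
  then show "u x = 0" using dominant_pairing_coeffs_zero[of "\<lambda>i. u (f i)" i] i by simp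
qed

lemma dominant_pairing_separates: "separates (w ` I) (span (f ` I))"
  unfolding separates_def
proof (intro ballI impI)
  fix y assume "y \<in> span (f ` I)" and zero: "\<forall>q\<in>w ` I. q \<bullet> y = 0"
  then obtain u where "y = (\<Sum>x\<in>f ` I. u x *\<^sub>R x)" using fin by (auto simp: span_finite)
  then have y: "y = (\<Sum>i\<in>I. u (f i) *\<^sub>R f i)" by (simp add: sum.reindex[OF dominant_pairing_inj_on])
  have "u (f i) = 0" if "i \<in> I" for i
    using dominant_pairing_coeffs_zero[of "\<lambda>i. u (f i)" i] zero that unfolding y by simp
  then show "y = 0" by (simp add: y)
qed

end

definition tuple_vec :: "('i \<times> 'b \<Rightarrow> real) \<Rightarrow> 'i \<Rightarrow> 'b::euclidean_space" where
  "tuple_vec t i = (\<Sum>b\<in>Basis. t (i, b) *\<^sub>R b)"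

lemma tuple_vec_tuple_coords: "i \<in> I \<Longrightarrow> tuple_vec (tuple_coords I V) i = V i"
  by (simp add: tuple_vec_def tuple_coords_def euclidean_representation)

lemma continuous_on_inner_tuple_vec: "continuous_on S (\<lambda>t. c \<bullet> tuple_vec t i)"
proof -
  have "continuous_on UNIV (\<lambda>t. \<Sum>b\<in>Basis. t (i, b) * (c \<bullet> b))"
    by (intro continuous_on_sum continuous_on_mult_right) simp
  then show ?thesis by (auto simp: tuple_vec_def inner_sum_right intro: continuous_on_subset)
qed

lemma sign_neighbourhood_exists:
  fixes p V0 :: "'i \<Rightarrow> 'e::euclidean_space"
  assumes "finite S" "S \<subseteq> W" and nonzero: "\<And>v. v \<in> S \<Longrightarrow> p v \<bullet> V0 v \<noteq> 0"
  obtains N where "open N" "tuple_coords W V0 \<in> N"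
    "\<And>t v. t \<in> N \<Longrightarrow> v \<in> S \<Longrightarrow> (p v \<bullet> tuple_vec t v) * (p v \<bullet> V0 v) > 0"
proof
  let ?N = "\<Inter>v\<in>S. {t. 0 < (p v \<bullet> tuple_vec t v) * (p v \<bullet> V0 v)}"
  show "open ?N" using assms(1)
    by (intro open_INT ballI open_Collect_less continuous_on_mult_right continuous_on_const
        continuous_on_inner_tuple_vec)
  have "(p v \<bullet> V0 v) * (p v \<bullet> V0 v) > 0" if "v \<in> S" for v
    using nonzero[OF that] by (metis not_real_square_gt_zero)
  then show "tuple_coords W V0 \<in> ?N"
    using assms(2) by (auto simp: tuple_vec_tuple_coords subset_iff)
qed blast

lemma locally_separated_by_ratios:
  fixes R :: "('i \<Rightarrow> 'e::euclidean_space) set" and Q :: "'i \<Rightarrow> 'e set"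
  assumes fin: "finite S" "\<And>v. v \<in> S \<Longrightarrow> finite (Q v)" and "S \<subseteq> W"
    and nonzero: "\<And>v. v \<in> S \<Longrightarrow> \<exists>q\<in>Q v. q \<bullet> V0 v \<noteq> 0"
    and U: "open U" "tuple_coords W V0 \<in> U"
    and sep: "\<And>V V'. V \<in> R \<Longrightarrow> V' \<in> R \<Longrightarrow> tuple_coords W V \<in> U \<Longrightarrow> tuple_coords W V' \<in> U \<Longrightarrow>
      \<forall>v\<in>S. proportional_on (Q v) (V v) (V' v) \<Longrightarrow> V = V'"
  shows "locally_separated_by (\<Sum>v\<in>S. card (Q v) - 1) (tuple_coords W ` R) (tuple_coords W V0)"
proof -
  obtain p where p: "\<And>v. v \<in> S \<Longrightarrow> p v \<in> Q v" "\<And>v. v \<in> S \<Longrightarrow> p v \<bullet> V0 v \<noteq> 0" using nonzero by metis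
  note vec = tuple_vec_tuple_coords[OF subsetD[OF \<open>S \<subseteq> W\<close>]]
  define K where "K = Sigma S (\<lambda>v. Q v - {p v})"
  define \<rho> where "\<rho> = (\<lambda>(v, q) t. (q \<bullet> tuple_vec t v) / (p v \<bullet> tuple_vec t v))"
  obtain N where N: "open N" "tuple_coords W V0 \<in> N"
    and sign: "\<And>t v. t \<in> N \<Longrightarrow> v \<in> S \<Longrightarrow> (p v \<bullet> tuple_vec t v) * (p v \<bullet> V0 v) > 0"
    using sign_neighbourhood_exists[of S W p V0] fin(1) \<open>S \<subseteq> W\<close> p(2) by blast
  show ?thesis
  proof (rule locally_separated_byI[of "U \<inter> N" _ K _ _ \<rho>])
    show "open (U \<inter> N)" "tuple_coords W V0 \<in> U \<inter> N" using U N by auto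
    show "finite K" unfolding K_def using fin by auto
    show "card K \<le> (\<Sum>v\<in>S. card (Q v) - 1)"
      unfolding K_def using fin p(1) by (simp add: card_Diff_singleton)
    fix k assume "k \<in> K"
    then obtain v q where k: "k = (v, q)" "v \<in> S" by (auto simp: K_def)
    have "p v \<bullet> tuple_vec t v \<noteq> 0" if "t \<in> N" for t using sign[OF that k(2)] by auto
    then show "continuous_on (tuple_coords W ` R \<inter> (U \<inter> N)) (\<rho> k)" unfolding k(1) \<rho>_def prod.case
      by (intro continuous_on_divide continuous_on_inner_tuple_vec) auto
  next
    fix t t' assume "t \<in> tuple_coords W ` R \<inter> (U \<inter> N)" "t' \<in> tuple_coords W ` R \<inter> (U \<inter> N)"
      and eq: "\<And>k. k \<in> K \<Longrightarrow> \<rho> k t = \<rho> k t'"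
    then obtain V V' where V: "V \<in> R" "t = tuple_coords W V" "t \<in> U \<inter> N"
      and V': "V' \<in> R" "t' = tuple_coords W V'" "t' \<in> U \<inter> N" by auto
    have "proportional_on (Q v) (V v) (V' v)" if v: "v \<in> S" for v
    proof (rule proportional_on_if_ratios_eq)
      show "0 < (p v \<bullet> V v) * (p v \<bullet> V0 v)" "0 < (p v \<bullet> V' v) * (p v \<bullet> V0 v)"
        using sign[of t v] sign[of t' v] V(2,3) V'(2,3) v by (simp_all add: vec)
      show "(q \<bullet> V v) / (p v \<bullet> V v) = (q \<bullet> V' v) / (p v \<bullet> V' v)" if "q \<in> Q v - {p v}" for q
        using eq[of "(v, q)"] v that V(2) V'(2) by (simp add: K_def \<rho>_def vec)
    qed
    then have "V = V'" using sep V V' by auto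
    then show "t = t'" using V V' by simp
  qed
qed

lemma configuration_neighbourhood_exists:
  fixes V0 :: "'i \<Rightarrow> 'e::euclidean_space"
  assumes "finite W" "I \<subseteq> W" "\<And>v. v \<in> W \<Longrightarrow> V0 v \<noteq> 0" "dominant_pairing I w V0"
  obtains U where "open U" "tuple_coords W V0 \<in> U"
    "\<And>V v. tuple_coords W V \<in> U \<Longrightarrow> v \<in> W \<Longrightarrow> V0 v \<bullet> V v > 0"
    "\<And>V. tuple_coords W V \<in> U \<Longrightarrow> dominant_pairing I w V"
proof
  define U where "U = (\<Inter>v\<in>W. {t. 0 < V0 v \<bullet> tuple_vec t v}) \<inter>
    (\<Inter>j\<in>I. {t. (\<Sum>i\<in>I - {j}. \<bar>w j \<bullet> tuple_vec t i\<bar>) < w j \<bullet> tuple_vec t j})"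
  have fin: "finite I" using assms(1,2) by (rule finite_subset[rotated])
  show "open U" unfolding U_def using assms(1) fin
    by (intro open_Int open_INT ballI open_Collect_less continuous_on_const continuous_on_sum
        continuous_on_rabs continuous_on_inner_tuple_vec) auto
  have "(\<Sum>i\<in>I - {j}. \<bar>w j \<bullet> tuple_vec (tuple_coords W V) i\<bar>) = (\<Sum>i\<in>I - {j}. \<bar>w j \<bullet> V i\<bar>)" for V j
    using assms(2) by (intro sum.cong) (auto simp: tuple_vec_tuple_coords)
  then have "tuple_coords W V \<in> U \<longleftrightarrow> (\<forall>v\<in>W. 0 < V0 v \<bullet> V v) \<and> dominant_pairing I w V" for V
    using assms(2) by (auto simp: U_def dominant_pairing_def tuple_vec_tuple_coords subset_iff)
  then show "tuple_coords W V0 \<in> U" "\<And>V v. tuple_coords W V \<in> U \<Longrightarrow> v \<in> W \<Longrightarrow> V0 v \<bullet> V v > 0"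
    "\<And>V. tuple_coords W V \<in> U \<Longrightarrow> dominant_pairing I w V"
    using assms(3,4) by auto
qed

text \<open>Up to a positive factor, the inner products with its test vectors determine a vector of the
  configuration. A vector of \<open>T - I\<close> lies in the span of those of \<open>I\<close> and thus takes only
  \<open>card I - 1\<close> parameters.\<close>

definition test_vectors :: "'i set \<Rightarrow> 'i set \<Rightarrow> ('i \<Rightarrow> 'e::euclidean_space) \<Rightarrow> 'i \<Rightarrow> 'e set" where
  "test_vectors T I w v = (if v \<in> T - I then w ` I else Basis)"

lemma finite_test_vectors: "finite I \<Longrightarrow> finite (test_vectors T I w v)"
  by (simp add: test_vectors_def)

lemma test_vectors_nonzero:
  assumes "finite I" "dominant_pairing I w V" "v \<in> T - I \<Longrightarrow> V v \<in> span (V ` I)" "V v \<noteq> 0"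
  shows "\<exists>q\<in>test_vectors T I w v. q \<bullet> V v \<noteq> 0"
proof -
  have "separates (test_vectors T I w v) (if v \<in> T - I then span (V ` I) else UNIV)"
    using dominant_pairing_separates[OF assms(1,2)] by (simp add: test_vectors_def separates_Basis)
  moreover have "V v \<in> (if v \<in> T - I then span (V ` I) else UNIV)" using assms(3) by auto
  ultimately show ?thesis using assms(4) unfolding separates_def by blast
qed

lemma sum_card_test_vectors:
  fixes w :: "'i \<Rightarrow> 'e::euclidean_space"
  assumes "finite T" "finite A" "I \<subseteq> T" "T \<inter> A = {}" "inj_on w I"
  shows "(\<Sum>v\<in>T \<union> A. card (test_vectors T I w v) - 1) =
    (card I + card A) * (DIM('e) - 1) + (card T - card I) * (card I - 1)"
proof -
  have finI: "finite I" using assms(3,1) by (rule finite_subset)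
  have "card (test_vectors T I w v) - 1 = (if v \<in> T - I then card I - 1 else DIM('e) - 1)" for v
    using assms(5) by (simp add: test_vectors_def card_image)
  moreover have "card (T - I) = card T - card I" using finI assms(3) by (simp add: card_Diff_subset)
  moreover have "card (I \<union> A) = card I + card A" using finI assms by (intro card_Un_disjoint) auto
  moreover have "(T \<union> A) \<inter> {v. v \<in> T - I} = T - I" "(T \<union> A) \<inter> - {v. v \<in> T - I} = I \<union> A"
    using assms(3,4) by auto
  ultimately show ?thesis using assms(1,2) by (simp add: sum.If_cases mult.commute)
qed

lemma configurations_eq_if_proportional_on:
  fixes V V' :: "'i \<Rightarrow> 'e::euclidean_space"
  assumes fin: "finite T" and I: "I \<subseteq> T"
    and unit: "\<And>v. v \<in> S \<Longrightarrow> norm (V v) = 1" "\<And>v. v \<in> S \<Longrightarrow> norm (V' v) = 1" and "T \<subseteq> S"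
    and dim: "dim (V ` T) = card I" "dim (V' ` T) = card I"
    and dom: "dominant_pairing I w V" "dominant_pairing I w V'"
    and proportional: "\<And>v. v \<in> S \<Longrightarrow> proportional_on (test_vectors T I w v) (V v) (V' v)"
    and "v \<in> S"
  shows "V v = V' v"
proof -
  have finI: "finite I" using fin I by (rule finite_subset[rotated])
  have free: "V v = V' v" if "v \<in> S" "v \<notin> T - I" for v
    using proportional[OF that(1)] that unit unfolding test_vectors_def
    by (intro unit_vectors_eq_if_proportional_on[OF subspace_UNIV separates_Basis, of "V v"]) auto
  then have VI: "V' ` I = V ` I" using I \<open>T \<subseteq> S\<close> by (intro image_cong) auto
  have in_span: "U v \<in> span (U ` I)" if "dim (U ` T) = card I" "dominant_pairing I w U" "v \<in> T"
    for U v
  proof -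
    have "card (U ` I) = card I" "independent (U ` I)"
      using dominant_pairing_inj_on[OF finI that(2)] dominant_pairing_independent[OF finI that(2)]
      by (auto simp: card_image)
    then have "U ` T \<subseteq> span (U ` I)" using that(1) I fin by (intro card_ge_dim_independent) auto
    then show ?thesis using that(3) by auto
  qed
  show ?thesis
  proof (cases "v \<in> T - I")
    case True
    then show ?thesis
      using proportional[OF \<open>v \<in> S\<close>, unfolded test_vectors_def] in_span[OF dim(1) dom(1), of v]
        in_span[OF dim(2) dom(2), of v] unit \<open>v \<in> S\<close>
      by (intro unit_vectors_eq_if_proportional_on[of _ _ "V v",
            OF subspace_span dominant_pairing_separates[OF finI dom(1)]])
        (auto simp: VI)
  qed (use free \<open>v \<in> S\<close> in blast)
qed

lemma configuration_space_dim_le: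
  fixes R :: "('i \<Rightarrow> 'e::euclidean_space) set" and W T A :: "'i set"
  assumes fin: "finite W" and sub: "T \<subseteq> W" "A \<subseteq> W" "T \<inter> A = {}"
    and unit: "\<And>V v. V \<in> R \<Longrightarrow> v \<in> W \<Longrightarrow> norm (V v) = 1"
    and dim: "\<And>V. V \<in> R \<Longrightarrow> dim (V ` T) = r"
    and determined: "\<And>V V'. V \<in> R \<Longrightarrow> V' \<in> R \<Longrightarrow> \<forall>v\<in>T \<union> A. V v = V' v \<Longrightarrow>
      \<forall>v\<in>W. V' v \<noteq> - V v \<Longrightarrow> V = V'"
  shows "semialgebraic_dim (W \<times> Basis) (tuple_coords W ` R) \<le>
    ereal (real ((r + card A) * (DIM('e) - 1) + (card T - r) * (r - 1)))"
proof (rule semialgebraic_dim_le_if_locally_separated, safe)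
  fix V0 assume V0: "V0 \<in> R"
  have finTA: "finite T" "finite A" using fin sub by (auto intro: finite_subset)
  obtain B where B: "B \<subseteq> V0 ` T" "independent B" "V0 ` T \<subseteq> span B" "card B = dim (V0 ` T)"
    by (rule basis_exists)
  then obtain I where I: "I \<subseteq> T" "inj_on V0 I" "B = V0 ` I" by (meson subset_image_inj)
  have finI: "finite I" using I(1) finTA(1) by (rule finite_subset)
  have cardI: "card I = r" using I B(4) dim[OF V0] by (simp add: card_image)
  obtain w where w: "inj_on w I" "dominant_pairing I w V0"
    using dominant_pairing_exists I B(2) by metis
  have nonzero: "V0 v \<noteq> 0" if "v \<in> W" for v using unit[OF V0 that] by auto
  have "I \<subseteq> W" using I(1) sub(1) by (rule subset_trans)
  then obtain U where U: "open U" "tuple_coords W V0 \<in> U"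
    "\<And>V v. tuple_coords W V \<in> U \<Longrightarrow> v \<in> W \<Longrightarrow> V0 v \<bullet> V v > 0"
    "\<And>V. tuple_coords W V \<in> U \<Longrightarrow> dominant_pairing I w V"
    using configuration_neighbourhood_exists[OF fin _ nonzero w(2)] by blast
  have "locally_separated_by (\<Sum>v\<in>T \<union> A. card (test_vectors T I w v) - 1)
    (tuple_coords W ` R) (tuple_coords W V0)"
  proof (rule locally_separated_by_ratios)
    show "finite (T \<union> A)" "T \<union> A \<subseteq> W" using finTA sub by auto
    show "finite (test_vectors T I w v)" for v using finI by (rule finite_test_vectors)
    show "\<exists>q\<in>test_vectors T I w v. q \<bullet> V0 v \<noteq> 0" if "v \<in> T \<union> A" for v
      using finI w(2) B(3) I(3) nonzero that sub by (intro test_vectors_nonzero) auto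
    show "V = V'" if V: "V \<in> R" "tuple_coords W V \<in> U" and V': "V' \<in> R" "tuple_coords W V' \<in> U"
      and "\<forall>v\<in>T \<union> A. proportional_on (test_vectors T I w v) (V v) (V' v)" for V V'
    proof (rule determined[OF V(1) V'(1)])
      show "\<forall>v\<in>T \<union> A. V v = V' v"
        using that(5) unit V V' sub dim U(4)
        by (intro ballI configurations_eq_if_proportional_on[OF finTA(1) I(1), of "T \<union> A" _ _ w])
          (auto simp: cardI)
      show "\<forall>v\<in>W. V' v \<noteq> - V v" using U(3)[OF V(2)] U(3)[OF V'(2)] by force
    qed
  qed (use U in auto)
  then show "locally_separated_by ((r + card A) * (DIM('e) - 1) + (card T - r) * (r - 1))
    (tuple_coords W ` R) (tuple_coords W V0)"
    unfolding sum_card_test_vectors[OF finTA I(1) sub(3) w(1)] cardI .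
qed

lemma dim_RS_le_if_corner_closure:
  fixes P :: "'a::euclidean_space set"
  assumes P: "polytope P" and F: "F face_of P"
    and T: "T \<subseteq> vertices P \<inter> F" and closure: "vertices P \<inter> F \<subseteq> corner_closure P T"
    and r: "aff_dim F + 1 = int r"
  shows "dim_RS P \<le> ereal (real ((r + card (vertices P - F)) * DIM('a) + (card T - r) * (r - 1)))"
proof -
  have "semialgebraic_dim (vertices P \<times> Basis) (tuple_coords (vertices P) ` realization_space P)
    \<le> ereal (real ((r + card (vertices P - F)) * (DIM('a \<times> real) - 1) + (card T - r) * (r - 1)))"
  proof (rule configuration_space_dim_le)
    show "finite (vertices P)" using P by (rule finite_vertices)
    show "T \<subseteq> vertices P" "vertices P - F \<subseteq> vertices P" "T \<inter> (vertices P - F) = {}" using T by auto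
    show "norm (V v) = 1" if "V \<in> realization_space P" "v \<in> vertices P" for V v
      using that by (rule realization_space_norm_eq_1)
    show "dim (V ` T) = r" if V: "V \<in> realization_space P" for V
    proof -
      have "V ` (vertices P \<inter> F) \<subseteq> span (V ` T)"
        using realization_corner_closure_in_span[OF P V] closure by blast
      then have "span (V ` T) = span (V ` (vertices P \<inter> F))"
        using T by (intro subset_antisym span_minimal span_mono) auto
      then have "dim (V ` T) = dim (V ` (vertices P \<inter> F))" by (metis dim_span)
      then show ?thesis using realization_space_dim_face[OF P V F] r by simp
    qed
    show "V = V'" if V: "V \<in> realization_space P" and V': "V' \<in> realization_space P"
      and agree: "\<forall>v\<in>T \<union> (vertices P - F). V v = V' v"
      and not_antipodal: "\<forall>v\<in>vertices P. V' v \<noteq> - V v" for V V'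
    proof (rule extensionalityI[of V "vertices P" V'])
      show "V \<in> extensional (vertices P)" "V' \<in> extensional (vertices P)"
        using V V' by (auto simp: realization_space_def PiE_iff)
      show "V v = V' v" if "v \<in> vertices P" for v
        using realizations_eq_on_corner_closure[OF P V V', of T v] agree not_antipodal closure that
        by auto
    qed
  qed
  then show ?thesis by (simp add: dim_RS_def)
qed

section \<open>Rotations and the Pell equation\<close>

definition turn :: "int \<Rightarrow> int \<Rightarrow> real" where
  "turn m n = 2 * pi * of_int n / of_int m"

lemma turn_0 [simp]: "turn m 0 = 0"
  by (simp add: turn_def)

lemma turn_1: "turn 4 1 = pi / 2" "turn 6 1 = pi / 3"
  by (simp_all add: turn_def)

lemma turn_add: "turn m (a + b) = turn m a + turn m b"
  by (simp add: turn_def add_divide_distrib algebra_simps)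

lemma turn_diff: "turn m (a - b) = turn m a - turn m b"
  by (simp add: turn_def diff_divide_distrib algebra_simps)

lemma cos_turn_eq_1_iff:
  assumes "m \<noteq> 0"
  shows "cos (turn m n) = 1 \<longleftrightarrow> m dvd n"
proof -
  have "turn m n = of_int q * 2 * pi \<longleftrightarrow> n = m * q" for q
  proof -
    have "turn m n = of_int q * 2 * pi \<longleftrightarrow> real_of_int n = real_of_int (m * q)"
      using assms by (auto simp: turn_def field_simps)
    then show ?thesis by (simp only: of_int_eq_iff)
  qed
  then show ?thesis by (auto simp: cos_one_2pi_int dvd_def)
qed

lemma cos_turn_mod: "m \<noteq> 0 \<Longrightarrow> cos (turn m (n mod m)) = cos (turn m n)"
  and sin_turn_mod: "m \<noteq> 0 \<Longrightarrow> sin (turn m (n mod m)) = sin (turn m n)"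
proof -
  assume "m \<noteq> 0"
  moreover have "turn m n = turn m (n mod m) + turn m (m * (n div m))" by (simp flip: turn_add)
  ultimately have "turn m n = turn m (n mod m) + 2 * pi * of_int (n div m)" by (simp add: turn_def)
  then show "cos (turn m (n mod m)) = cos (turn m n)" "sin (turn m (n mod m)) = sin (turn m n)"
    by (simp_all add: cos_add sin_add cos_int_2pin sin_int_2pin)
qed

lemma cos_sin_turn_4:
  "n mod 4 = 0 \<Longrightarrow> cos (turn 4 n) = 1 \<and> sin (turn 4 n) = 0"
  "n mod 4 = 1 \<Longrightarrow> cos (turn 4 n) = 0 \<and> sin (turn 4 n) = 1"
  "n mod 4 = 2 \<Longrightarrow> cos (turn 4 n) = - 1 \<and> sin (turn 4 n) = 0"
  "n mod 4 = 3 \<Longrightarrow> cos (turn 4 n) = 0 \<and> sin (turn 4 n) = - 1"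
proof -
  have "turn 4 2 = pi" by (simp add: turn_def)
  moreover have "turn 4 3 = turn 4 1 + turn 4 2" by (simp flip: turn_add)
  ultimately have "cos (turn 4 3) = 0" "sin (turn 4 3) = - 1"
    by (simp_all only: cos_add sin_add) (simp_all add: turn_1)
  then show
    "n mod 4 = 0 \<Longrightarrow> cos (turn 4 n) = 1 \<and> sin (turn 4 n) = 0"
    "n mod 4 = 1 \<Longrightarrow> cos (turn 4 n) = 0 \<and> sin (turn 4 n) = 1"
    "n mod 4 = 2 \<Longrightarrow> cos (turn 4 n) = - 1 \<and> sin (turn 4 n) = 0"
    "n mod 4 = 3 \<Longrightarrow> cos (turn 4 n) = 0 \<and> sin (turn 4 n) = - 1"
    using cos_turn_mod[of 4 n] sin_turn_mod[of 4 n] \<open>turn 4 2 = pi\<close> by (auto simp: turn_1)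
qed

lemma two_cos_turn_6_odd:
  assumes "odd d"
  shows "2 * cos (turn 6 d) \<le> 1" "2 * cos (turn 6 d) = 1 \<longleftrightarrow> d mod 6 \<in> {1, 5}"
proof -
  have turns: "turn 6 3 = pi" "turn 6 6 = 2 * pi" by (simp_all add: turn_def)
  have "cos (turn 6 5) = cos (turn 6 6 - turn 6 1)" by (simp flip: turn_diff)
  also have "\<dots> = 1 / 2" unfolding cos_diff by (simp add: turns turn_1 cos_60)
  finally have vals: "cos (turn 6 1) = 1 / 2" "cos (turn 6 3) = - 1" "cos (turn 6 5) = 1 / 2"
    by (simp_all add: turns turn_1 cos_60)
  have "d mod 6 = 1 \<or> d mod 6 = 3 \<or> d mod 6 = 5" using assms by presburger
  then show "2 * cos (turn 6 d) \<le> 1" "2 * cos (turn 6 d) = 1 \<longleftrightarrow> d mod 6 \<in> {1, 5}"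
    using cos_turn_mod[of 6 d] vals by auto
qed

definition pell_x :: "nat \<Rightarrow> real" where
  "pell_x i = cosh (real i * arcosh 2)"

definition pell_y :: "nat \<Rightarrow> real" where
  "pell_y i = sinh (real i * arcosh 2) / sqrt 3"

lemma sinh_arcosh_2: "sinh (arcosh 2 :: real) = sqrt 3"
proof -
  have "(sinh (arcosh 2 :: real))\<^sup>2 = 3" by (simp add: sinh_square_eq)
  then show ?thesis
    by (metis arcosh_nonneg_real one_le_numeral real_sqrt_unique sinh_real_nonneg_iff)
qed

lemma pell_0 [simp]: "pell_x 0 = 1" "pell_y 0 = 0"
  by (simp_all add: pell_x_def pell_y_def)

lemma pell_Suc:
  "pell_x (Suc i) = 2 * pell_x i + 3 * pell_y i"
  "pell_y (Suc i) = pell_x i + 2 * pell_y i"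
  by (simp_all add: pell_x_def pell_y_def distrib_right cosh_add sinh_add sinh_arcosh_2 field_simps)

lemma pell_equation: "(pell_x i)\<^sup>2 = 1 + 3 * (pell_y i)\<^sup>2"
  by (simp add: pell_x_def pell_y_def power_divide cosh_square_eq)

lemma pell_x_ge_1: "pell_x i \<ge> 1"
  by (simp add: pell_x_def cosh_real_ge_1)

lemma pell_x_pos [simp]: "pell_x i > 0"
  by (simp add: pell_x_def)

lemma pell_x_nonzero [simp]: "pell_x i \<noteq> 0"
  by (simp add: pell_x_def)

lemma pell_y_nonneg [simp]: "pell_y i \<ge> 0"
  by (simp add: pell_y_def)

lemma pell_x_inject: "pell_x i = pell_x j \<longleftrightarrow> i = j"
proof -
  have "pell_x k < pell_x (Suc k)" for k
    using pell_x_pos[of k] pell_y_nonneg[of k] unfolding pell_Suc by linarith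
  then have "strict_mono pell_x" by (simp add: strict_mono_Suc_iff)
  then show ?thesis by (rule strict_mono_eq)
qed

definition pell_gap :: "nat \<Rightarrow> nat \<Rightarrow> real" where
  "pell_gap i j = pell_x i * pell_x j - 3 * pell_y i * pell_y j"

lemma pell_gap_eq_cosh: "pell_gap i j = cosh ((real i - real j) * arcosh 2)"
  by (simp add: pell_gap_def pell_x_def pell_y_def left_diff_distrib cosh_diff)

lemma pell_gap_refl [simp]: "pell_gap i i = 1"
  by (simp add: pell_gap_eq_cosh)

lemma pell_gap_Suc [simp]: "pell_gap i (Suc i) = 2" "pell_gap (Suc i) i = 2"
  by (simp_all add: pell_gap_eq_cosh)

lemma pell_gap_gt_2:
  assumes "i \<noteq> j" "i \<noteq> Suc j" "j \<noteq> Suc i"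
  shows "pell_gap i j > 2"
proof -
  have "2 \<le> \<bar>real i - real j\<bar>" using assms by linarith
  then have "2 * arcosh 2 \<le> \<bar>real i - real j\<bar> * arcosh 2" by (intro mult_right_mono) auto
  then have "cosh (2 * arcosh 2) \<le> cosh (\<bar>real i - real j\<bar> * arcosh 2)"
    by (subst cosh_real_nonneg_le_iff) auto
  also have "\<dots> = cosh \<bar>(real i - real j) * arcosh 2\<bar>" by (simp add: abs_mult)
  also have "\<dots> = pell_gap i j" by (simp add: pell_gap_eq_cosh cosh_real_abs)
  also have "cosh (2 * arcosh 2 :: real) = 7" by (simp add: cosh_double_cosh)
  finally show ?thesis by simp
qed

section \<open>Supporting functionals of lattice cubes\<close>

text \<open>Offsets from the centre of a lattice square with middle vertices in layer \<open>l\<close>, over one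
  geodesic.\<close>

definition square_offset :: "nat \<Rightarrow> nat \<Rightarrow> int \<Rightarrow> bool" where
  "square_offset l i d \<longleftrightarrow> i = l \<and> d mod 6 \<in> {1, 5} \<or> (i = Suc l \<or> l = Suc i) \<and> d mod 6 = 0"

lemma two_cos_le_pell_gap:
  assumes "odd (int i + int l + d)"
  shows "2 * cos (turn 6 d) \<le> pell_gap i l"
    and "pell_gap i l = 2 * cos (turn 6 d) \<longleftrightarrow> square_offset l i d"
proof -
  have cos_eq_1_iff: "cos (turn 6 d) = 1 \<longleftrightarrow> d mod 6 = 0"
    by (simp add: cos_turn_eq_1_iff dvd_eq_mod_eq_0)
  consider (same) "i = l" | (adjacent) "i = Suc l \<or> l = Suc i"
    | (far) "i \<noteq> l" "i \<noteq> Suc l" "l \<noteq> Suc i" by blast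
  then have "2 * cos (turn 6 d) \<le> pell_gap i l \<and>
    (pell_gap i l = 2 * cos (turn 6 d) \<longleftrightarrow> square_offset l i d)"
  proof cases
    case same
    then have "odd d" using assms by simp
    then show ?thesis using two_cos_turn_6_odd[of d] same by (auto simp: square_offset_def)
  next
    case adjacent
    then show ?thesis using cos_eq_1_iff by (auto simp: square_offset_def)
  next
    case far
    then have "2 * cos (turn 6 d) < pell_gap i l"
      using pell_gap_gt_2[OF far] cos_le_one[of "turn 6 d"] by linarith
    then show ?thesis using far by (auto simp: square_offset_def)
  qed
  then show "2 * cos (turn 6 d) \<le> pell_gap i l"
    "pell_gap i l = 2 * cos (turn 6 d) \<longleftrightarrow> square_offset l i d" by auto
qed

text \<open>The hyperbolic part of the functional vanishing on a lattice cube, evaluated in layer \<open>i\<close> on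
  the geodesic that is \<open>m\<close> quarter turns away from the upper square of the cube. The lower square has
  its two middle vertices in layer \<open>j\<close>.\<close>

definition cube_level :: "nat \<Rightarrow> nat \<Rightarrow> int \<Rightarrow> real" where
  "cube_level j i m =
    pell_y j * (pell_x i * cos (turn 4 m) - 3 * pell_y i * sin (turn 4 m)) -
    (pell_x j + 2 * pell_y j) * (pell_x i * sin (turn 4 m) + 3 * pell_y i * cos (turn 4 m)) +
    (pell_x j + pell_y j) * (2 * pell_x i)"

lemma cube_level_on_cube:
  "m mod 4 = 0 \<Longrightarrow> cube_level j i m = pell_gap i (Suc j)"
  "m mod 4 = 1 \<Longrightarrow> cube_level j i m = pell_gap i j"
  by (simp_all add: cube_level_def cos_sin_turn_4 pell_gap_def pell_Suc algebra_simps)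

lemma cube_level_opposite_ge_2:
  assumes "m mod 4 = 2"
  shows "cube_level j i m \<ge> 2" "cube_level j i m = 2 \<longleftrightarrow> i = 0 \<and> j = 0"
proof -
  have level: "cube_level j i m =
      2 * (pell_x i * pell_x j) +
      (pell_x i * pell_y j + 3 * (pell_y i * pell_x j) + 6 * (pell_y i * pell_y j))"
    by (simp add: cube_level_def cos_sin_turn_4(3)[OF assms] algebra_simps)
  have "pell_x i * pell_y j \<ge> 0" "pell_y i * pell_x j \<ge> 0" "pell_y i * pell_y j \<ge> 0"
    by (simp_all add: less_imp_le)
  then have "cube_level j i m \<ge> 2 * (pell_x i * pell_x j)" unfolding level by linarith
  moreover have "pell_x i * 1 \<le> pell_x i * pell_x j" "1 * pell_x j \<le> pell_x i * pell_x j"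
    using pell_x_ge_1 by (intro mult_left_mono mult_right_mono; simp add: less_imp_le)+
  ultimately have ge: "cube_level j i m \<ge> 2 * pell_x i" "cube_level j i m \<ge> 2 * pell_x j"
    by linarith+
  then show "cube_level j i m \<ge> 2" using pell_x_ge_1[of i] by linarith
  have "pell_x i = pell_x 0 \<and> pell_x j = pell_x 0" if "cube_level j i m = 2"
    using ge that pell_x_ge_1[of i] pell_x_ge_1[of j] by simp
  then show "cube_level j i m = 2 \<longleftrightarrow> i = 0 \<and> j = 0" unfolding pell_x_inject by (auto simp: level)
qed

lemma cube_level_adjacent_gt_2:
  assumes "m mod 4 = 3"
  shows "cube_level j i m > 2"
proof -
  have "1 * 1 \<le> pell_x i * pell_x j" using pell_x_ge_1 by (intro mult_mono) (auto simp: less_imp_le)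
  moreover have "pell_x i * pell_y j \<ge> 0" "pell_y i * pell_y j \<ge> 0" by (simp_all add: less_imp_le)
  moreover have "cube_level j i m =
      3 * (pell_x i * pell_x j) + 4 * (pell_x i * pell_y j) + 3 * (pell_y i * pell_y j)"
    by (simp add: cube_level_def cos_sin_turn_4(4)[OF assms] algebra_simps)
  ultimately show ?thesis by linarith
qed

text \<open>For \<open>j = 0\<close> the lowest vertex of the cube is missing, but its functional also vanishes at a
  vertex of layer 0 on the opposite geodesic.\<close>

definition cube_offset :: "nat \<Rightarrow> nat \<Rightarrow> int \<Rightarrow> int \<Rightarrow> bool" where
  "cube_offset j i m d \<longleftrightarrow>
     m mod 4 = 0 \<and> square_offset (Suc j) i d \<or> m mod 4 = 1 \<and> square_offset j i d \<or>
     m mod 4 = 2 \<and> i = 0 \<and> j = 0 \<and> d mod 6 = 0"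

lemma two_cos_le_cube_level:
  assumes "even (int i + int j + m + d)"
  shows "2 * cos (turn 6 d) \<le> cube_level j i m"
    and "cube_level j i m = 2 * cos (turn 6 d) \<longleftrightarrow> cube_offset j i m d"
proof -
  have cos_eq_1_iff: "cos (turn 6 d) = 1 \<longleftrightarrow> d mod 6 = 0"
    by (simp add: cos_turn_eq_1_iff dvd_eq_mod_eq_0)
  consider (upper) "m mod 4 = 0" | (lower) "m mod 4 = 1" | (opposite) "m mod 4 = 2"
    | (adjacent) "m mod 4 = 3"
    using pos_mod_bound[of 4 m] pos_mod_sign[of 4 m] by linarith
  then have "2 * cos (turn 6 d) \<le> cube_level j i m \<and>
    (cube_level j i m = 2 * cos (turn 6 d) \<longleftrightarrow> cube_offset j i m d)"
  proof cases
    case upper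
    have "odd (int i + int (Suc j) + d)" using assms upper by simp presburger
    then show ?thesis
      using two_cos_le_pell_gap[of i "Suc j" d] upper
      by (simp add: cube_level_on_cube cube_offset_def)
  next
    case lower
    have "odd (int i + int j + d)" using assms lower by presburger
    then show ?thesis
      using two_cos_le_pell_gap[of i j d] lower by (simp add: cube_level_on_cube cube_offset_def)
  next
    case opposite
    then have "2 * cos (turn 6 d) \<le> cube_level j i m"
      "cube_level j i m = 2 * cos (turn 6 d) \<longleftrightarrow> cube_level j i m = 2 \<and> cos (turn 6 d) = 1"
      using cube_level_opposite_ge_2(1)[OF opposite, of j i] cos_le_one[of "turn 6 d"] by linarith+
    then show ?thesis
      using cube_level_opposite_ge_2(2)[OF opposite, of j i] cos_eq_1_iff opposite
      by (simp add: cube_offset_def)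
  next
    case adjacent
    then have "2 * cos (turn 6 d) < cube_level j i m"
      using cube_level_adjacent_gt_2[OF adjacent, of j i] cos_le_one[of "turn 6 d"] by linarith
    then show ?thesis using adjacent by (simp add: cube_offset_def)
  qed
  then show "2 * cos (turn 6 d) \<le> cube_level j i m"
    "cube_level j i m = 2 * cos (turn 6 d) \<longleftrightarrow> cube_offset j i m d" by auto
qed

section \<open>The point configuration\<close>

locale four_basis_vectors =
  fixes b0 b1 b2 b3 :: "'a::euclidean_space"
  assumes basis: "{b0, b1, b2, b3} \<subseteq> Basis" and dist: "distinct [b0, b1, b2, b3]"
begin

lemma inner_basis [simp]:
  "b0 \<bullet> b0 = 1" "b1 \<bullet> b1 = 1" "b2 \<bullet> b2 = 1" "b3 \<bullet> b3 = 1"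
  "b0 \<bullet> b1 = 0" "b0 \<bullet> b2 = 0" "b0 \<bullet> b3 = 0" "b1 \<bullet> b0 = 0" "b1 \<bullet> b2 = 0" "b1 \<bullet> b3 = 0"
  "b2 \<bullet> b0 = 0" "b2 \<bullet> b1 = 0" "b2 \<bullet> b3 = 0" "b3 \<bullet> b0 = 0" "b3 \<bullet> b1 = 0" "b3 \<bullet> b2 = 0"
  using basis dist by (auto simp: inner_not_same_Basis)

definition vec4 :: "real \<Rightarrow> real \<Rightarrow> real \<Rightarrow> real \<Rightarrow> 'a" where
  "vec4 x y z u = x *\<^sub>R b0 + y *\<^sub>R b1 + z *\<^sub>R b2 + u *\<^sub>R b3"

lemma inner_vec4: "vec4 x y z u \<bullet> vec4 x' y' z' u' = x * x' + y * y' + z * z' + u * u'"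
  by (simp add: vec4_def inner_add_left inner_add_right)

lemma vec4_linear:
  "vec4 x y z u + vec4 x' y' z' u' = vec4 (x + x') (y + y') (z + z') (u + u')"
  "vec4 x y z u - vec4 x' y' z' u' = vec4 (x - x') (y - y') (z - z') (u - u')"
  "c *\<^sub>R vec4 x y z u = vec4 (c * x) (c * y) (c * z) (c * u)"
  by (simp_all add: vec4_def algebra_simps)

text \<open>Together with the omitted coordinate \<open>2 * pell_x i\<close>, the first two coordinates are
  $\sqrt 3$ times a point of the hyperboloid model, at distance \<open>i * arcosh 2\<close> from the midpoint of
  the \<open>n\<close>-th side of the quadrilateral; the last two give the angle $k\pi/3$ on the circle.\<close>

definition lifted_point :: "nat \<Rightarrow> int \<Rightarrow> int \<Rightarrow> 'a" where
  "lifted_point i n k = vec4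
     (pell_x i * cos (turn 4 n) - 3 * pell_y i * sin (turn 4 n))
     (pell_x i * sin (turn 4 n) + 3 * pell_y i * cos (turn 4 n))
     (sqrt 3 * cos (turn 6 k)) (sqrt 3 * sin (turn 6 k))"

definition lattice_point :: "nat \<Rightarrow> int \<Rightarrow> int \<Rightarrow> 'a" where
  "lattice_point i n k = (1 / (2 * pell_x i)) *\<^sub>R lifted_point i n k"

lemma lifted_point_eq_scaleR: "lifted_point i n k = (2 * pell_x i) *\<^sub>R lattice_point i n k"
  by (simp add: lattice_point_def)

lemma inner_lifted_point:
  "lifted_point i n k \<bullet> lifted_point i' n' k' =
    (pell_x i * pell_x i' + 9 * pell_y i * pell_y i') * cos (turn 4 (n - n')) +
    3 * (pell_x i * pell_y i' - pell_y i * pell_x i') * sin (turn 4 (n - n')) +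
    3 * cos (turn 6 (k - k'))"
proof -
  have "(c * x - 3 * s * y) * (c' * x' - 3 * s' * y') +
      (c * y + 3 * s * x) * (c' * y' + 3 * s' * x') +
      sqrt 3 * z * (sqrt 3 * z') + sqrt 3 * u * (sqrt 3 * u') =
    (c * c' + 9 * s * s') * (x * x' + y * y') + 3 * (c * s' - s * c') * (y * x' - x * y') +
      3 * (z * z' + u * u')"
    for c c' s s' x x' y y' z z' u u' :: real
  proof -
    have "sqrt 3 * z * (sqrt 3 * z') = 3 * (z * z')" "sqrt 3 * u * (sqrt 3 * u') = 3 * (u * u')"
      by simp_all
    then show ?thesis by (simp only:) (simp add: algebra_simps)
  qed
  then show ?thesis
    unfolding turn_diff cos_diff sin_diff lifted_point_def inner_vec4 by (simp only:)
qed

lemma norm_lattice_point: "norm (lattice_point i n k) = 1"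
proof -
  have "lifted_point i n k \<bullet> lifted_point i n k = (2 * pell_x i)\<^sup>2"
    using pell_equation[of i] by (simp add: inner_lifted_point power2_eq_square algebra_simps)
  then have "norm (lifted_point i n k) = 2 * pell_x i"
    by (simp add: norm_eq_sqrt_inner real_sqrt_mult less_imp_le)
  then show ?thesis by (simp add: lattice_point_def less_imp_le)
qed

lemma lattice_point_cong:
  assumes "n mod 4 = n' mod 4" "k mod 6 = k' mod 6"
  shows "lattice_point i n k = lattice_point i n' k'"
proof -
  have "cos (turn 4 n) = cos (turn 4 n')" "sin (turn 4 n) = sin (turn 4 n')"
    using assms(1) cos_turn_mod[of 4] sin_turn_mod[of 4] by (metis zero_neq_numeral)+
  moreover have "cos (turn 6 k) = cos (turn 6 k')" "sin (turn 6 k) = sin (turn 6 k')"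
    using assms(2) cos_turn_mod[of 6] sin_turn_mod[of 6] by (metis zero_neq_numeral)+
  ultimately show ?thesis by (simp add: lattice_point_def lifted_point_def)
qed

lemma lattice_point_eq_imp_layer_eq:
  assumes "lattice_point i n k = lattice_point i' n' k'"
  shows "i = i'"
proof -
  have norm_sq: "(vec4 0 0 1 0 \<bullet> lattice_point i n k)\<^sup>2 + (vec4 0 0 0 1 \<bullet> lattice_point i n k)\<^sup>2 =
      3 / (4 * (pell_x i)\<^sup>2)" for i n k
  proof -
    have "(vec4 0 0 1 0 \<bullet> lattice_point i n k)\<^sup>2 + (vec4 0 0 0 1 \<bullet> lattice_point i n k)\<^sup>2 =
        3 * ((cos (turn 6 k))\<^sup>2 + (sin (turn 6 k))\<^sup>2) / (4 * (pell_x i)\<^sup>2)"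
      unfolding distrib_left add_divide_distrib
      by (simp add: lattice_point_def lifted_point_def inner_vec4 power_mult_distrib power_divide)
    then show ?thesis by (simp only: sin_cos_squared_add2 mult_1_right)
  qed
  have "3 / (4 * (pell_x i)\<^sup>2) = 3 / (4 * (pell_x i')\<^sup>2)"
    using norm_sq[of i n k] norm_sq[of i' n' k'] assms by simp
  then have "(pell_x i)\<^sup>2 = (pell_x i')\<^sup>2" by (simp add: field_simps)
  then have "pell_x i = pell_x i'" by (simp add: less_imp_le)
  then show ?thesis by (simp add: pell_x_inject)
qed

lemma lattice_point_eq_iff:
  "lattice_point i n k = lattice_point i' n' k' \<longleftrightarrow> i = i' \<and> n mod 4 = n' mod 4 \<and> k mod 6 = k' mod 6"
proof
  assume eq: "lattice_point i n k = lattice_point i' n' k'"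
  then have i: "i = i'" by (rule lattice_point_eq_imp_layer_eq)
  let ?n = "cos (turn 4 (n - n'))" and ?k = "cos (turn 6 (k - k'))"
  have "lifted_point i n k \<bullet> lifted_point i n' k' = lifted_point i n k \<bullet> lifted_point i n k"
    using eq i by (simp add: lifted_point_eq_scaleR)
  then have "((pell_x i)\<^sup>2 + 9 * (pell_y i)\<^sup>2) * (1 - ?n) + 3 * (1 - ?k) = 0"
    unfolding inner_lifted_point by (simp add: power2_eq_square algebra_simps)
  moreover have "(pell_x i)\<^sup>2 + 9 * (pell_y i)\<^sup>2 > 0" by (simp add: add_pos_nonneg)
  moreover have "1 - ?n \<ge> 0" "1 - ?k \<ge> 0" by simp_all
  ultimately have "?n = 1" "?k = 1" by (smt (verit) mult_nonneg_nonneg mult_pos_pos)+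
  then show "i = i' \<and> n mod 4 = n' mod 4 \<and> k mod 6 = k' mod 6"
    using i by (simp add: cos_turn_eq_1_iff mod_eq_dvd_iff)
qed (use lattice_point_cong in blast)

definition layers :: "nat set \<Rightarrow> 'a set" where
  "layers I = {lattice_point i n k | i n k. i \<in> I \<and> even (int i + n + k)}"

definition apexes :: "'a set" where
  "apexes = Basis - {b0, b1, b2, b3}"

definition vertex_set :: "nat \<Rightarrow> 'a set" where
  "vertex_set N = layers {..N} \<union> apexes"

definition layer_polytope :: "nat \<Rightarrow> 'a set" where
  "layer_polytope N = convex hull vertex_set N"

lemma layersI: "i \<in> I \<Longrightarrow> even (int i + n + k) \<Longrightarrow> lattice_point i n k \<in> layers I"
  by (auto simp: layers_def)

lemma layers_mono: "I \<subseteq> J \<Longrightarrow> layers I \<subseteq> layers J"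
  by (auto simp: layers_def)

lemma bij_betw_layers:
  "bij_betw (\<lambda>(i, n, r). lattice_point i n (2 * r + (int i + n) mod 2))
     (I \<times> {0..<4} \<times> {0..<3}) (layers I)"
    (is "bij_betw ?f ?D _")
proof (rule bij_betw_imageI)
  show "inj_on ?f ?D"
  proof (rule inj_onI)
    fix x y assume "x \<in> ?D" "y \<in> ?D" and eq: "?f x = ?f y"
    then obtain i n r i' n' r' where x: "x = (i, n, r)" "0 \<le> n" "n < 4" "0 \<le> r" "r < 3"
      and y: "y = (i', n', r')" "0 \<le> n'" "n' < 4" "0 \<le> r'" "r' < 3" by auto
    have in_eq: "i = i'" "n = n'" using eq x y by (simp_all add: lattice_point_eq_iff)
    have "(2 * r + (int i + n) mod 2) mod 6 = (2 * r' + (int i + n) mod 2) mod 6"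
      using eq x(1) y(1) in_eq by (simp add: lattice_point_eq_iff)
    moreover have "(2 * s + (int i + n) mod 2) mod 6 = 2 * s + (int i + n) mod 2" if "0 \<le> s" "s < 3"
      for s
      using that pos_mod_bound[of 2 "int i + n"] by (intro mod_pos_pos_trivial) auto
    ultimately have "r = r'" using x(4,5) y(4,5) by simp
    then show "x = y" using in_eq x(1) y(1) by simp
  qed
  show "?f ` ?D = layers I"
  proof
    show "layers I \<subseteq> ?f ` ?D"
    proof
      fix x assume "x \<in> layers I"
      then obtain i n k where x: "i \<in> I" "even (int i + n + k)" "x = lattice_point i n k"
        by (auto simp: layers_def)
      have "k mod 6 = 2 * (k mod 6 div 2) + (int i + n mod 4) mod 2" using x(2) by presburger
      then have "x = ?f (i, n mod 4, k mod 6 div 2)" using x(3) by (simp add: lattice_point_eq_iff)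
      moreover have "k mod 6 div 2 \<in> {0..<3}" by auto
      ultimately show "x \<in> ?f ` ?D"
        using x(1) by (intro image_eqI[where x = "(i, n mod 4, k mod 6 div 2)"]) auto
    qed
  qed (auto intro!: layersI)
qed

lemma finite_layers: "finite I \<Longrightarrow> finite (layers I)"
  using bij_betw_finite[OF bij_betw_layers[of I]] by simp

lemma card_layers: "card (layers I) = 12 * card I"
  using bij_betw_same_card[OF bij_betw_layers[of I]] by (simp add: card_cartesian_product)

lemma vec4_inner_apex: "x \<in> apexes \<Longrightarrow> vec4 p q r s \<bullet> x = 0"
  using basis by (auto simp: apexes_def vec4_def inner_add_left inner_not_same_Basis)

lemma lattice_point_inner_apex: "x \<in> apexes \<Longrightarrow> lattice_point i n k \<bullet> x = 0"
  by (simp add: lattice_point_def lifted_point_def vec4_inner_apex)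

lemma finite_apexes: "finite apexes"
  by (simp add: apexes_def)

lemma card_apexes: "card apexes = DIM('a) - 4"
  using basis dist by (simp add: apexes_def card_Diff_subset)

lemma layers_Int_apexes: "layers I \<inter> apexes = {}"
proof -
  have "lattice_point i n k \<notin> apexes" for i n k
    using lattice_point_inner_apex[of "lattice_point i n k" i n k] norm_lattice_point[of i n k]
    by auto
  then show ?thesis by (auto simp: layers_def)
qed

lemma finite_vertex_set: "finite (vertex_set N)"
  by (simp add: vertex_set_def finite_layers finite_apexes)

lemma DIM_ge_4: "DIM('a) \<ge> 4"
proof -
  have "card {b0, b1, b2, b3} \<le> DIM('a)" using basis by (intro card_mono) auto
  then show ?thesis using dist by simp
qed

lemma card_vertex_set: "card (vertex_set N) = 12 * (N + 1) + DIM('a) - 4"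
  using card_Un_disjoint[OF finite_layers[of "{..N}"] finite_apexes layers_Int_apexes[of "{..N}"]]
    DIM_ge_4
  by (simp add: vertex_set_def card_layers card_apexes)

lemma vertex_set_subset_sphere: "vertex_set N \<subseteq> sphere 0 1"
  by (auto simp: vertex_set_def layers_def apexes_def norm_lattice_point)

lemma vertices_layer_polytope: "vertices (layer_polytope N) = vertex_set N"
  unfolding layer_polytope_def
  by (rule vertices_convex_hull_subset_sphere[OF vertex_set_subset_sphere])

lemma polytope_layer_polytope: "polytope (layer_polytope N)"
  by (simp add: layer_polytope_def polytope_convex_hull finite_vertex_set)

lemma hyperplane_coefficients_zero:
  assumes "\<And>n k. even (n + k) \<Longrightarrow> a \<bullet> lattice_point 0 n k = \<beta>"
  shows "\<beta> = 0" "a \<bullet> b0 = 0" "a \<bullet> b1 = 0" "a \<bullet> b2 = 0" "a \<bullet> b3 = 0"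
proof -
  have eq: "a \<bullet> b0 * cos (turn 4 n) + a \<bullet> b1 * sin (turn 4 n) +
      sqrt 3 * (a \<bullet> b2 * cos (turn 6 k) + a \<bullet> b3 * sin (turn 6 k)) = 2 * \<beta>"
    if "even (n + k)" for n k
  proof -
    have "a \<bullet> lifted_point 0 n k = 2 * \<beta>" using assms[OF that] by (simp add: lifted_point_eq_scaleR)
    then show ?thesis by (simp add: lifted_point_def vec4_def inner_add_right algebra_simps)
  qed
  have turns: "turn 6 3 = pi" "turn 6 2 = 2 * pi / 3" by (simp_all add: turn_def)
  have "a \<bullet> b0 + sqrt 3 * (a \<bullet> b2) = 2 * \<beta>" "- (a \<bullet> b0) + sqrt 3 * (a \<bullet> b2) = 2 * \<beta>"
    "a \<bullet> b1 - sqrt 3 * (a \<bullet> b2) = 2 * \<beta>" "- (a \<bullet> b1) - sqrt 3 * (a \<bullet> b2) = 2 * \<beta>"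
    using eq[of 0 0] eq[of 2 0] eq[of 1 3] eq[of 3 3] by (simp_all add: cos_sin_turn_4 turns)
  then have "\<beta> = 0" "a \<bullet> b0 = 0" "a \<bullet> b1 = 0" "sqrt 3 * (a \<bullet> b2) = 0" by linarith+
  then show "\<beta> = 0" "a \<bullet> b0 = 0" "a \<bullet> b1 = 0" "a \<bullet> b2 = 0" by simp_all
  then show "a \<bullet> b3 = 0" using eq[of 0 2] by (simp add: turns sin_120)
qed

lemma aff_dim_vertex_set: "aff_dim (vertex_set N) = int DIM('a)"
proof (rule ccontr)
  assume "aff_dim (vertex_set N) \<noteq> int DIM('a)"
  then have "aff_dim (vertex_set N) < int DIM('a)"
    using aff_dim_le_DIM[of "vertex_set N"] by linarith
  then obtain a \<beta> where a: "a \<noteq> 0" "vertex_set N \<subseteq> {x. a \<bullet> x = \<beta>}"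
    by (rule aff_lowdim_subset_hyperplane)
  have "lattice_point 0 n k \<in> vertex_set N" if "even (n + k)" for n k
    using that by (auto simp: vertex_set_def intro!: layersI)
  then have zero: "\<beta> = 0" "a \<bullet> b0 = 0" "a \<bullet> b1 = 0" "a \<bullet> b2 = 0" "a \<bullet> b3 = 0"
    using a(2) hyperplane_coefficients_zero[of a \<beta>] by blast+
  moreover have "a \<bullet> b = 0" if "b \<in> apexes" for b
    using that a(2) zero(1) by (auto simp: vertex_set_def)
  ultimately have "a \<bullet> b = 0" if "b \<in> Basis" for b using that by (auto simp: apexes_def)
  then show False using a(1) euclidean_all_zero_iff by blast
qed

lemma aff_dim_layers: "aff_dim (layers {..N}) = 4"
proof (rule antisym)
  have "int DIM('a) \<le> aff_dim (layers {..N}) + int (card apexes)"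
    using aff_dim_Un_le_card[OF finite_apexes, of "layers {..N}"] aff_dim_vertex_set[of N]
    by (simp add: vertex_set_def)
  then show "aff_dim (layers {..N}) \<ge> 4" using card_apexes DIM_ge_4 by simp
  have "vec4 p q r s \<in> span {b0, b1, b2, b3}" for p q r s
    unfolding vec4_def by (intro span_add span_scale span_base) auto
  then have "layers {..N} \<subseteq> span {b0, b1, b2, b3}"
    by (auto simp: layers_def lattice_point_def lifted_point_def intro!: span_scale)
  then have "aff_dim (layers {..N}) \<le> aff_dim (span {b0, b1, b2, b3})" by (rule aff_dim_subset)
  also have "\<dots> = int (dim {b0, b1, b2, b3})" by (simp add: aff_dim_subspace)
  also have "dim {b0, b1, b2, b3} \<le> card {b0, b1, b2, b3}" by (intro dim_le_card') auto
  also have "card {b0, b1, b2, b3} \<le> 4" by (simp add: card_insert_if)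
  finally show "aff_dim (layers {..N}) \<le> 4" by simp
qed

section \<open>Faces and corners of the polytopes\<close>

definition cube_normal :: "int \<Rightarrow> nat \<Rightarrow> int \<Rightarrow> 'a" where
  "cube_normal n0 j k0 = vec4
     (pell_y j * cos (turn 4 n0) + (pell_x j + 2 * pell_y j) * sin (turn 4 n0))
     (pell_y j * sin (turn 4 n0) - (pell_x j + 2 * pell_y j) * cos (turn 4 n0))
     (- 2 / sqrt 3 * cos (turn 6 k0)) (- 2 / sqrt 3 * sin (turn 6 k0))"

definition cube_functional :: "int \<Rightarrow> nat \<Rightarrow> int \<Rightarrow> 'a \<Rightarrow> real" where
  "cube_functional n0 j k0 x = cube_normal n0 j k0 \<bullet> x + (pell_x j + pell_y j)"

lemma cube_functional_lattice_point:
  "2 * pell_x i * cube_functional n0 j k0 (lattice_point i n k) =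
    cube_level j i (n - n0) - 2 * cos (turn 6 (k - k0))"
proof -
  have identity: "(s' * x' + (c' + 2 * s') * y') * (c * x - 3 * s * y) +
      (s' * y' - (c' + 2 * s') * x') * (c * y + 3 * s * x) +
      - 2 / sqrt 3 * z' * (sqrt 3 * z) + - 2 / sqrt 3 * u' * (sqrt 3 * u) + h =
    s' * (c * (x * x' + y * y') - 3 * s * (y * x' - x * y')) -
      (c' + 2 * s') * (c * (y * x' - x * y') + 3 * s * (x * x' + y * y')) + h -
      2 * (z * z' + u * u')"
    for c c' s s' x x' y y' z z' u u' h :: real
  proof -
    have "- 2 / sqrt 3 * z' * (sqrt 3 * z) = - 2 * (z * z')"
      "- 2 / sqrt 3 * u' * (sqrt 3 * u) = - 2 * (u * u')"
      by simp_all
    then show ?thesis by (simp only:) (simp add: algebra_simps)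
  qed
  have scale: "2 * pell_x i * (v \<bullet> lattice_point i n k + h) =
      v \<bullet> lifted_point i n k + h * (2 * pell_x i)" for v h
    by (simp add: lattice_point_def field_simps)
  show ?thesis
    unfolding cube_functional_def cube_normal_def scale cube_level_def turn_diff cos_diff sin_diff
      lifted_point_def inner_vec4
    by (rule identity)
qed

lemma cube_functional_lattice_point_nonneg:
  assumes "even (int j + n0 + k0)" "even (int i + n + k)"
  shows "cube_functional n0 j k0 (lattice_point i n k) \<ge> 0"
    and "cube_functional n0 j k0 (lattice_point i n k) = 0 \<longleftrightarrow> cube_offset j i (n - n0) (k - k0)"
proof -
  have "even (int i + int j + (n - n0) + (k - k0))" using assms by auto
  note level = two_cos_le_cube_level[OF this]
  have "2 * pell_x i * cube_functional n0 j k0 (lattice_point i n k) \<ge> 0"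
    using level(1) by (simp add: cube_functional_lattice_point)
  then show "cube_functional n0 j k0 (lattice_point i n k) \<ge> 0"
    using pell_x_pos[of i] by (auto simp: zero_le_mult_iff)
  have "cube_functional n0 j k0 (lattice_point i n k) = 0 \<longleftrightarrow>
      2 * pell_x i * cube_functional n0 j k0 (lattice_point i n k) = 0" by simp
  also have "\<dots> \<longleftrightarrow> cube_level j i (n - n0) = 2 * cos (turn 6 (k - k0))"
    unfolding cube_functional_lattice_point by (rule right_minus_eq)
  also have "\<dots> \<longleftrightarrow> cube_offset j i (n - n0) (k - k0)" by (rule level(2))
  finally show "cube_functional n0 j k0 (lattice_point i n k) = 0 \<longleftrightarrow>
    cube_offset j i (n - n0) (k - k0)" .
qed

lemma cube_functional_apex_pos:
  assumes "x \<in> apexes"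
  shows "cube_functional n0 j k0 x > 0"
proof -
  have "cube_functional n0 j k0 x = pell_x j + pell_y j"
    unfolding cube_functional_def cube_normal_def vec4_inner_apex[OF assms] by simp
  then show ?thesis by (simp add: add_pos_nonneg)
qed

lemma cube_functional_nonneg:
  assumes "even (int j + n0 + k0)" "x \<in> vertex_set N"
  shows "cube_functional n0 j k0 x \<ge> 0"
proof (cases "x \<in> apexes")
  case True
  then show ?thesis using cube_functional_apex_pos less_imp_le by blast
next
  case False
  then obtain i n k where "even (int i + n + k)" "x = lattice_point i n k"
    using assms(2) unfolding vertex_set_def layers_def by blast
  then show ?thesis using cube_functional_lattice_point_nonneg(1)[OF assms(1)] by simp
qed

definition layer_cube :: "nat \<Rightarrow> int \<Rightarrow> nat \<Rightarrow> int \<Rightarrow> 'a set" where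
  "layer_cube N n0 j k0 = {x \<in> vertex_set N. cube_functional n0 j k0 x = 0}"

lemma layer_cube_subset_layers: "layer_cube N n0 j k0 \<subseteq> layers {..N}"
proof
  fix x assume "x \<in> layer_cube N n0 j k0"
  then show "x \<in> layers {..N}"
    using cube_functional_apex_pos[of x n0 j k0] by (auto simp: layer_cube_def vertex_set_def)
qed

lemma lattice_point_in_layer_cube_iff:
  assumes "even (int j + n0 + k0)" "even (int i + n + k)" "i \<le> N"
  shows "lattice_point i n k \<in> layer_cube N n0 j k0 \<longleftrightarrow> cube_offset j i (n - n0) (k - k0)"
proof -
  have "lattice_point i n k \<in> vertex_set N"
    using layersI[OF _ assms(2)] assms(3) by (simp add: vertex_set_def)
  then show ?thesis
    using cube_functional_lattice_point_nonneg(2)[OF assms(1,2)] by (simp add: layer_cube_def)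
qed

lemma vertex_set_of_2face_layer_cubes:
  assumes "even (int j + n0 + k0)" "even (int j' + n0' + k0')"
    and Q: "layer_cube N n0 j k0 \<inter> layer_cube N n0' j' k0' = Q" "aff_dim Q \<le> 2"
  shows "vertex_set_of_2face (layer_polytope N) Q"
proof -
  define a where "a = cube_normal n0 j k0 + cube_normal n0' j' k0'"
  define \<beta> where "\<beta> = (pell_x j + pell_y j) + (pell_x j' + pell_y j')"
  have sum: "cube_functional n0 j k0 x + cube_functional n0' j' k0' x = a \<bullet> x + \<beta>" for x
    by (simp add: cube_functional_def a_def \<beta>_def inner_add_left)
  have nonneg: "a \<bullet> x + \<beta> \<ge> 0" if "x \<in> vertex_set N" for x
    using cube_functional_nonneg[OF assms(1) that] cube_functional_nonneg[OF assms(2) that]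
    by (simp flip: sum)
  have "Q = {x \<in> vertex_set N. a \<bullet> x + \<beta> = 0}"
    using cube_functional_nonneg[OF assms(1)] cube_functional_nonneg[OF assms(2)]
    unfolding Q(1)[symmetric] sum[symmetric] layer_cube_def by (auto simp: add_nonneg_eq_0_iff)
  then have "convex hull Q face_of layer_polytope N" "vertex_set N \<inter> convex hull Q = Q"
    using convex_hull_zeros_face_of[OF finite_vertex_set nonneg]
    by (simp_all add: layer_polytope_def)
  then show ?thesis
    unfolding vertex_set_of_2face_def vertices_layer_polytope
    using Q(2) by (metis aff_dim_convex_hull)
qed

lemma aff_dim_lattice_points_le_2:
  assumes "lifted_point i n k =
      x *\<^sub>R lifted_point i1 n1 k1 + y *\<^sub>R lifted_point i2 n2 k2 + z *\<^sub>R lifted_point i3 n3 k3"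
    and "pell_x i = x * pell_x i1 + y * pell_x i2 + z * pell_x i3"
  shows "aff_dim {lattice_point i n k, lattice_point i1 n1 k1, lattice_point i2 n2 k2,
    lattice_point i3 n3 k3} \<le> 2"
proof (rule aff_dim_le_2_if_affine_combination)
  show "lattice_point i n k = (x * pell_x i1 / pell_x i) *\<^sub>R lattice_point i1 n1 k1 +
      (y * pell_x i2 / pell_x i) *\<^sub>R lattice_point i2 n2 k2 +
      (z * pell_x i3 / pell_x i) *\<^sub>R lattice_point i3 n3 k3"
    unfolding lattice_point_def[of i] assms(1)
    by (simp add: lifted_point_eq_scaleR scaleR_add_right field_simps)
  show "x * pell_x i1 / pell_x i + y * pell_x i2 / pell_x i + z * pell_x i3 / pell_x i = 1"
    by (simp add: assms(2)[symmetric] flip: add_divide_distrib)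
qed

lemma diff_mod_eq_iff:
  fixes a b c m :: int
  assumes "0 \<le> c" "c < m"
  shows "(a - b) mod m = c \<longleftrightarrow> a mod m = (b + c) mod m"
proof -
  have "(a - b) mod m = c \<longleftrightarrow> (a - b) mod m = c mod m" using assms by simp
  also have "\<dots> \<longleftrightarrow> a mod m = (b + c) mod m" by (simp only: mod_eq_dvd_iff diff_diff_eq)
  finally show ?thesis .
qed

lemma square_offset_diff_iff:
  "square_offset l i (k' - k) \<longleftrightarrow>
     i = l \<and> (k' mod 6 = (k - 1) mod 6 \<or> k' mod 6 = (k + 1) mod 6) \<or>
     (i = Suc l \<or> l = Suc i) \<and> k' mod 6 = k mod 6"
proof -
  have "(k + 5) mod 6 = (k - 1) mod 6" by (simp add: mod_eq_dvd_iff)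
  then show ?thesis
    using diff_mod_eq_iff[of 0 6 k' k] diff_mod_eq_iff[of 1 6 k' k] diff_mod_eq_iff[of 5 6 k' k]
    by (auto simp: square_offset_def)
qed

lemma cube_offset_quarter_turn:
  assumes "cube_offset i i' m d" "cube_offset (Suc i) i' (m + 1) d"
  shows "m mod 4 = 0" "square_offset (Suc i) i' d"
proof -
  define p q where "p = m mod 4" and "q = (m + 1) mod 4"
  have "q = (p + 1) mod 4" by (simp add: p_def q_def mod_add_left_eq)
  moreover have "q = 0 \<or> q = 1" using assms(2) by (auto simp: cube_offset_def q_def)
  moreover have "p = 0 \<or> p = 1 \<or> p = 2" "p = 0 \<Longrightarrow> square_offset (Suc i) i' d"
    using assms(1) unfolding cube_offset_def p_def[symmetric] by auto
  ultimately show "m mod 4 = 0" "square_offset (Suc i) i' d" by (auto simp flip: p_def)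
qed

lemma cube_offset_consecutive:
  assumes "cube_offset i i' m d" "cube_offset (Suc i) i' m d'"
  shows "m mod 4 = 0 \<and> (i' = Suc (Suc i) \<and> d mod 6 = 0 \<or> i' = Suc i \<and> d' mod 6 = 0) \<or>
    m mod 4 = 1 \<and> (i' = Suc i \<and> d mod 6 = 0 \<or> i' = i \<and> d' mod 6 = 0)"
proof -
  define p a b where "p = m mod 4" and "a = d mod 6" and "b = d' mod 6"
  show ?thesis
    using assms
    unfolding cube_offset_def square_offset_def p_def[symmetric] a_def[symmetric] b_def[symmetric]
    by auto
qed

text \<open>A flat square lies over one geodesic, a steep square over two adjacent ones.\<close>

definition flat_square :: "nat \<Rightarrow> int \<Rightarrow> int \<Rightarrow> 'a set" where
  "flat_square i n k =
     {lattice_point (Suc (Suc i)) n k, lattice_point (Suc i) n (k - 1),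
      lattice_point (Suc i) n (k + 1), lattice_point i n k}"

definition steep_square :: "int \<Rightarrow> nat \<Rightarrow> int \<Rightarrow> int \<Rightarrow> 'a set" where
  "steep_square e i n k =
     {lattice_point (Suc (Suc i)) n k, lattice_point (Suc i) n (k + e),
      lattice_point (Suc i) (n + 1) k, lattice_point i (n + 1) (k + e)}"

lemma aff_dim_flat_square: "aff_dim (flat_square i n k) \<le> 2"
  unfolding flat_square_def
proof (rule aff_dim_lattice_points_le_2[where x = 2 and y = 2 and z = "- 1"])
  show "lifted_point (Suc (Suc i)) n k =
      2 *\<^sub>R lifted_point (Suc i) n (k - 1) + 2 *\<^sub>R lifted_point (Suc i) n (k + 1) +
      - 1 *\<^sub>R lifted_point i n k"
    unfolding lifted_point_def vec4_linear turn_add turn_diff turn_1 cos_add cos_diff sin_add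
      sin_diff cos_60 sin_60
    by (simp add: pell_Suc algebra_simps)
  show "pell_x (Suc (Suc i)) = 2 * pell_x (Suc i) + 2 * pell_x (Suc i) + - 1 * pell_x i"
    by (simp add: pell_Suc)
qed

lemma lifted_point_steep_edge:
  "lifted_point (Suc i) n k - lifted_point i (n + 1) k = (2 * pell_x i + 6 * pell_y i) *\<^sub>R
    vec4 (cos (turn 4 n) - sin (turn 4 n)) (cos (turn 4 n) + sin (turn 4 n)) 0 0"
  unfolding lifted_point_def vec4_linear turn_add turn_1 cos_add sin_add cos_pi_half sin_pi_half
  by (simp add: pell_Suc algebra_simps)

lemma aff_dim_steep_square: "aff_dim (steep_square e i n k) \<le> 2"
proof -
  define \<rho> where "\<rho> = (2 * pell_x (Suc i) + 6 * pell_y (Suc i)) / (2 * pell_x i + 6 * pell_y i)"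
  have "2 * pell_x i + 6 * pell_y i > 0" by (simp add: add_pos_nonneg)
  then have \<rho>: "\<rho> * (2 * pell_x i + 6 * pell_y i) = 2 * pell_x (Suc i) + 6 * pell_y (Suc i)"
    by (simp add: \<rho>_def)
  have "lifted_point (Suc (Suc i)) n k - lifted_point (Suc i) (n + 1) k =
      \<rho> *\<^sub>R (lifted_point (Suc i) n (k + e) - lifted_point i (n + 1) (k + e))"
    unfolding lifted_point_steep_edge scaleR_scaleR \<rho> ..
  then have "lifted_point (Suc (Suc i)) n k = \<rho> *\<^sub>R lifted_point (Suc i) n (k + e) +
      1 *\<^sub>R lifted_point (Suc i) (n + 1) k + (- \<rho>) *\<^sub>R lifted_point i (n + 1) (k + e)"
    by (simp add: algebra_simps)
  moreover have "pell_x (Suc (Suc i)) = \<rho> * pell_x (Suc i) + 1 * pell_x (Suc i) + (- \<rho>) * pell_x i"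
    using \<rho> by (simp add: pell_Suc algebra_simps)
  ultimately show ?thesis unfolding steep_square_def by (rule aff_dim_lattice_points_le_2)
qed

context
  fixes N i :: nat and n k :: int
  assumes N: "Suc (Suc i) \<le> N" and parity: "even (int i + n + k)"
begin

lemma flat_square_eq_layer_cubes:
  "layer_cube N n i k \<inter> layer_cube N (n - 1) (Suc i) k = flat_square i n k"
proof (intro equalityI subsetI)
  note in_cube_iff = lattice_point_in_layer_cube_iff[of i n k]
    lattice_point_in_layer_cube_iff[of "Suc i" "n - 1" k]
  fix x assume x: "x \<in> layer_cube N n i k \<inter> layer_cube N (n - 1) (Suc i) k"
  then have "x \<in> layers {..N}" using layer_cube_subset_layers by blast
  then obtain i' n' k' where x_eq: "x = lattice_point i' n' k'" "i' \<le> N" "even (int i' + n' + k')"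
    by (auto simp: layers_def)
  then have "cube_offset i i' (n' - n) (k' - k)" "cube_offset (Suc i) i' (n' - (n - 1)) (k' - k)"
    using x parity by (simp_all add: in_cube_iff)
  moreover have "n' - (n - 1) = n' - n + 1" by simp
  ultimately have "(n' - n) mod 4 = 0" and k': "square_offset (Suc i) i' (k' - k)"
    using cube_offset_quarter_turn[of i i' "n' - n" "k' - k"] by simp_all
  then have n': "n' mod 4 = n mod 4" by (simp only: mod_eq_dvd_iff dvd_eq_mod_eq_0)
  show "x \<in> flat_square i n k"
    using n' k'
    unfolding x_eq(1) flat_square_def lattice_point_eq_iff insert_iff square_offset_diff_iff
    by blast
next
  have "even (int (Suc i) + n + (k - 1))" "even (int (Suc i) + n + (k + 1))" using parity by auto
  then show "x \<in> layer_cube N n i k \<inter> layer_cube N (n - 1) (Suc i) k" if "x \<in> flat_square i n k"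
    for x
    using that N parity unfolding flat_square_def
    by (elim insertE emptyE)
      (simp_all add: lattice_point_in_layer_cube_iff cube_offset_def square_offset_def)
qed

lemma steep_square_eq_layer_cubes:
  assumes e: "e \<in> {1, - 1}"
  shows "layer_cube N n i k \<inter> layer_cube N n (Suc i) (k + e) = steep_square e i n k"
proof (intro equalityI subsetI)
  note in_cube_iff = lattice_point_in_layer_cube_iff[of i n k]
    lattice_point_in_layer_cube_iff[of "Suc i" n "k + e"]
  have parity': "even (int (Suc i) + n + (k + e))" using parity e by auto
  fix x assume x: "x \<in> layer_cube N n i k \<inter> layer_cube N n (Suc i) (k + e)"
  then have "x \<in> layers {..N}" using layer_cube_subset_layers by blast
  then obtain i' n' k' where x_eq: "x = lattice_point i' n' k'" "i' \<le> N" "even (int i' + n' + k')"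
    by (auto simp: layers_def)
  then have "cube_offset i i' (n' - n) (k' - k)" "cube_offset (Suc i) i' (n' - n) (k' - (k + e))"
    using x parity parity' by (simp_all add: in_cube_iff)
  then have "(n' - n) mod 4 = 0 \<and>
        (i' = Suc (Suc i) \<and> (k' - k) mod 6 = 0 \<or> i' = Suc i \<and> (k' - (k + e)) mod 6 = 0) \<or>
      (n' - n) mod 4 = 1 \<and>
        (i' = Suc i \<and> (k' - k) mod 6 = 0 \<or> i' = i \<and> (k' - (k + e)) mod 6 = 0)"
    by (rule cube_offset_consecutive)
  then show "x \<in> steep_square e i n k"
    unfolding x_eq(1) steep_square_def lattice_point_eq_iff insert_iff
    by (simp add: diff_mod_eq_iff) blast
next
  have "even (int (Suc i) + n + (k + e))" "even (int (Suc i) + (n + 1) + k)"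
    "even (int i + (n + 1) + (k + e))"
    using parity e by auto
  then show "x \<in> layer_cube N n i k \<inter> layer_cube N n (Suc i) (k + e)" if "x \<in> steep_square e i n k"
    for x
    using e that N parity unfolding steep_square_def
    by (elim insertE emptyE)
      (simp_all add: lattice_point_in_layer_cube_iff cube_offset_def square_offset_def)
qed

lemma lattice_point_cubical_corner:
  "cubical_corner (layer_polytope N) (lattice_point (Suc (Suc i)) n k)
     (lattice_point (Suc i) n (k - 1)) (lattice_point (Suc i) n (k + 1))
     (lattice_point (Suc i) (n + 1) k) (lattice_point i n k)
     (lattice_point i (n + 1) (k - 1)) (lattice_point i (n + 1) (k + 1))"
proof -
  have flat: "vertex_set_of_2face (layer_polytope N) (flat_square i n k)"
    using flat_square_eq_layer_cubes aff_dim_flat_square parity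
    by (intro vertex_set_of_2face_layer_cubes) auto
  have steep: "vertex_set_of_2face (layer_polytope N) (steep_square e i n k)" if "e \<in> {1, - 1}"
    for e
    using steep_square_eq_layer_cubes[OF that] aff_dim_steep_square parity that
    by (intro vertex_set_of_2face_layer_cubes) auto
  have "lattice_point j m l \<noteq> lattice_point j' m' l'" if "j \<noteq> j'" for j j' m m' l l'
    using that lattice_point_eq_imp_layer_eq by blast
  moreover have "lattice_point j n l \<noteq> lattice_point j (n + 1) l'" for j l l'
    unfolding lattice_point_eq_iff by (simp add: mod_eq_dvd_iff)
  moreover have "lattice_point j m (k - 1) \<noteq> lattice_point j m (k + 1)" for j m
    unfolding lattice_point_eq_iff by (simp add: mod_eq_dvd_iff)
  ultimately show ?thesis
    using flat steep[of 1] steep[of "- 1"]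
    by (simp add: cubical_corner_def flat_square_def steep_square_def)
qed

end

lemma layers_subset_corner_closure:
  "layers {..N} \<subseteq> corner_closure (layer_polytope N) (layers {..1})"
proof -
  have "lattice_point i n k \<in> corner_closure (layer_polytope N) (layers {..1})"
    if "i \<le> N" "even (int i + n + k)" for i n k
    using that
  proof (induction i arbitrary: n k rule: less_induct)
    case (less i)
    consider (seed) "i \<le> 1" | (corner) i' where "i = Suc (Suc i')"
      by (metis One_nat_def not0_implies_Suc not_less_eq_eq zero_le)
    then show ?case
    proof cases
      case seed
      then show ?thesis using less.prems by (intro corner_closure.seed layersI) auto
    next
      case (corner i')
      then have parity: "Suc (Suc i') \<le> N" "even (int i' + n + k)" using less.prems by simp_all
      have lower: "lattice_point j m l \<in> corner_closure (layer_polytope N) (layers {..1})"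
        if "j < Suc (Suc i')" "even (int j + m + l)" for j m l
        using less.IH[of j m l] that corner less.prems(1) by simp
      have even: "even (int (Suc i') + n + (k - 1))" "even (int (Suc i') + n + (k + 1))"
        "even (int (Suc i') + (n + 1) + k)"
        "even (int i' + (n + 1) + (k - 1))" "even (int i' + (n + 1) + (k + 1))"
        using parity(2) by auto
      show ?thesis
        unfolding corner using even[THEN lower[rotated]] parity(2)[THEN lower[rotated]]
        by (intro corner_closure.corner[OF lattice_point_cubical_corner[OF parity]]) simp
    qed
  qed
  then show ?thesis by (auto simp: layers_def)
qed

lemma layers_face_of_layer_polytope:
  "convex hull layers {..N} face_of layer_polytope N"
  "vertex_set N \<inter> convex hull layers {..N} = layers {..N}"
proof -
  have layers: "\<Sum>apexes \<bullet> x = 0" if "x \<in> layers {..N}" for x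
    using that lattice_point_inner_apex
    by (auto simp: layers_def inner_sum_left inner_commute intro!: sum.neutral)
  have apexes: "\<Sum>apexes \<bullet> x = 1" if "x \<in> apexes" for x
  proof -
    have "\<Sum>apexes \<bullet> x = (\<Sum>y\<in>apexes. if y = x then 1 else 0)"
      unfolding inner_sum_left using that by (intro sum.cong) (auto simp: apexes_def inner_Basis)
    then show ?thesis using that finite_apexes by simp
  qed
  have "\<Sum>apexes \<bullet> x + 0 \<ge> 0" if "x \<in> vertex_set N" for x
    using that layers apexes by (auto simp: vertex_set_def)
  moreover have "{x \<in> vertex_set N. \<Sum>apexes \<bullet> x + 0 = 0} = layers {..N}"
    using layers apexes by (force simp: vertex_set_def)
  ultimately show "convex hull layers {..N} face_of layer_polytope N"
    "vertex_set N \<inter> convex hull layers {..N} = layers {..N}"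
    using convex_hull_zeros_face_of[OF finite_vertex_set, of N "\<Sum>apexes" 0]
    by (simp_all add: layer_polytope_def)
qed

lemma dim_RS_layer_polytope_le:
  assumes "N \<ge> 1"
  shows "dim_RS (layer_polytope N) \<le> ereal (real (76 + DIM('a) * (DIM('a) + 1)))"
proof -
  let ?F = "convex hull layers {..N}"
  note face = layers_face_of_layer_polytope[of N]
  have vertices: "vertices (layer_polytope N) \<inter> ?F = layers {..N}"
    using face(2) by (simp add: vertices_layer_polytope)
  have "dim_RS (layer_polytope N) \<le>
    ereal (real ((5 + card (vertices (layer_polytope N) - ?F)) * DIM('a) +
      (card (layers {..1}) - 5) * (5 - 1)))"
  proof (rule dim_RS_le_if_corner_closure[OF polytope_layer_polytope face(1)])
    show "layers {..1} \<subseteq> vertices (layer_polytope N) \<inter> ?F"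
      unfolding vertices using assms by (intro layers_mono) auto
    show "vertices (layer_polytope N) \<inter> ?F \<subseteq> corner_closure (layer_polytope N) (layers {..1})"
      unfolding vertices by (rule layers_subset_corner_closure)
    show "aff_dim ?F + 1 = int 5" by (simp add: aff_dim_convex_hull aff_dim_layers)
  qed
  also have "(5 + card (vertices (layer_polytope N) - ?F)) * DIM('a) +
      (card (layers {..1}) - 5) * (5 - 1) =
      76 + DIM('a) * (DIM('a) + 1)"
  proof -
    have "vertices (layer_polytope N) - ?F = apexes"
      using face(2) layers_Int_apexes[of "{..N}"]
      by (auto simp: vertices_layer_polytope vertex_set_def)
    then have "5 + card (vertices (layer_polytope N) - ?F) = DIM('a) + 1"
      using DIM_ge_4 by (simp add: card_apexes)
    then show ?thesis by (simp only: card_layers) (simp add: algebra_simps)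
  qed
  finally show ?thesis .
qed

lemma inscribed_layer_polytope: "inscribed (layer_polytope N)"
  unfolding inscribed_def vertices_layer_polytope
  using vertex_set_subset_sphere by (intro exI[of _ 0] exI[of _ 1]) simp

lemma aff_dim_layer_polytope: "aff_dim (layer_polytope N) = int DIM('a)"
  by (simp add: layer_polytope_def aff_dim_convex_hull aff_dim_vertex_set)

lemma layer_polytope_not_comb_equiv:
  assumes "M \<noteq> N"
  shows "\<not> comb_equiv (layer_polytope M) (layer_polytope N)"
  using comb_equiv_card_vertices_eq[OF polytope_layer_polytope polytope_layer_polytope, of M N]
    assms DIM_ge_4
  by (auto simp: vertices_layer_polytope card_vertex_set)

end

lemma four_basis_vectors_exist:
  assumes "DIM('a::euclidean_space) \<ge> 4"
  obtains b0 b1 b2 b3 :: "'a::euclidean_space" where "four_basis_vectors b0 b1 b2 b3"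
proof -
  obtain B :: "'a set"
    where B: "B \<subseteq> Basis" "card B = 4" using assms by (meson obtain_subset_with_card_n)
  then obtain xs where xs: "set xs = B" "distinct xs" "length xs = 4"
    by (metis card_gt_0_iff distinct_card finite_distinct_list zero_less_numeral)
  then obtain b0 b1 b2 b3 where "xs = [b0, b1, b2, b3]"
    by (auto simp: numeral_eq_Suc length_Suc_conv)
  then show thesis using that[of b0 b1 b2 b3] xs B by (auto simp: four_basis_vectors_def)
qed

theorem theoremA32:
  fixes d :: nat
  assumes "d \<ge> 4" and "CARD('n::finite) = d"
  shows "\<exists>P :: nat \<Rightarrow> (real ^ 'n) set.
           (\<forall>n\<ge>1. polytope (P n) \<and> aff_dim (P n) = int d \<and> inscribed (P n) \<and>
                   card (vertices (P n)) = 12 * (n + 1) + d - 4 \<and>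
                   dim_RS (P n) \<le> ereal (real (76 + d * (d + 1)))) \<and>
           (\<forall>m\<ge>1. \<forall>n\<ge>1. m \<noteq> n \<longrightarrow> \<not> comb_equiv (P m) (P n))"
proof -
  have d: "DIM(real ^ 'n) = d" using assms by simp
  obtain b0 b1 b2 b3 :: "real ^ 'n" where "four_basis_vectors b0 b1 b2 b3"
    using four_basis_vectors_exist d assms(1) by metis
  then interpret four_basis_vectors b0 b1 b2 b3 .
  show ?thesis
  proof (intro exI[of _ layer_polytope] conjI allI impI)
    fix n :: nat assume "n \<ge> 1"
    show "polytope (layer_polytope n)" by (rule polytope_layer_polytope)
    show "aff_dim (layer_polytope n) = int d" unfolding aff_dim_layer_polytope d ..
    show "inscribed (layer_polytope n)" by (rule inscribed_layer_polytope)
    show "card (vertices (layer_polytope n)) = 12 * (n + 1) + d - 4"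
      unfolding vertices_layer_polytope card_vertex_set d ..
    show "dim_RS (layer_polytope n) \<le> ereal (real (76 + d * (d + 1)))"
      using dim_RS_layer_polytope_le[OF \<open>n \<ge> 1\<close>] unfolding d .
  qed (rule layer_polytope_not_comb_equiv)
qed

end
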